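(* For every $d\ge 2$ there exists an irreducible affine iterated function system $(T_i)_{i\in\mathcal{I}}$ acting on $\mathbb{R}^d$, with attractor $X$ and coding map $\Pi$, such that: among the measures $\Pi_*\mu$ with $\mu$ a shift-invariant Borel probability measure on $\mathcal{I}^{\mathbb{N}}$ there is a unique one whose dimension equals the Hausdorff dimension of $X$, and this measure is $\Pi_*\mu$ for an ergodic $\mu$; and there exist linear projections $Q$ of $\mathbb{R}^d$ onto lower-dimensional linear subspaces such that the measure $Q_*\Pi_*\mu$ is not exact-dimensional.
   Context: An affine iterated function system is a finite tuple of maps $T_ix=A_ix+u_i$ with $A_i\in\mathrm{GL}_d(\mathbb{R})$, $u_i\in\mathbb{R}^d$, all contracting with respect to some common norm on $\mathbb{R}^d$. It is irreducible if no linear subspace of $\mathbb{R}^d$ other than $\{0\}$ and $\mathbb{R}^d$ is preserved by all the $A_i$. Its attractor is the unique nonempty compact set $X$ with $X=\bigcup_iT_iX$. The coding map $\Pi:\mathcal{I}^{\mathbb{N}}\to X$ is $\Pi[(i_k)_{k=1}^\infty]=\lim_{n\to\infty}T_{i_1}T_{i_2}\cdots T_{i_n}v$ (independent of $v\in\mathbb{R}^d$). The shift is $\sigma[(i_k)_{k\ge1}]=(i_{k+1})_{k\ge1}$. For a Borel probability measure $\nu$ on $\mathbb{R}^d$ and $x\in\operatorname{supp}\nu$, the upper and lower local dimensions are the $\limsup$ and $\liminf$ as $r\to0$ of $\log\nu(\mathbf{B}_d(x,r))/\log r$, where $\mathbf{B}_d(x,r)$ is the closed ball. The measure $\nu$ is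 exact-dimensional if the upper and lower local dimensions are $\nu$-a.e. equal and constant; the common value is called the dimension of $\nu$. *)

theory Defs
  imports "HOL-Probability.Probability"
begin

text \<open>
  A finite tuple of affine maps \<open>T\<^sub>i x = A\<^sub>i x + u\<^sub>i\<close> is given by its length \<open>m\<close> together with
  \<open>A :: nat \<Rightarrow> real^'n^'n\<close> and \<open>u :: nat \<Rightarrow> real^'n\<close>; only the values at indices
  \<open>i < m\<close> are part of the tuple, i.e. the index set is \<open>{..<m}\<close>.
\<close>

definition affine_map :: "(nat \<Rightarrow> real^'n^'n) \<Rightarrow> (nat \<Rightarrow> real^'n) \<Rightarrow> nat \<Rightarrow> real^'n \<Rightarrow> real^'n" where
  "affine_map A u i x = A i *v x + u i"

definition is_norm :: "('a::real_vector \<Rightarrow> real) \<Rightarrow> bool" where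
  "is_norm N \<longleftrightarrow>
     (\<forall>x. 0 \<le> N x) \<and> (\<forall>x. N x = 0 \<longleftrightarrow> x = 0) \<and>
     (\<forall>c x. N (c *\<^sub>R x) = \<bar>c\<bar> * N x) \<and> (\<forall>x y. N (x + y) \<le> N x + N y)"

definition affine_ifs :: "nat \<Rightarrow> (nat \<Rightarrow> real^'n^'n) \<Rightarrow> (nat \<Rightarrow> real^'n) \<Rightarrow> bool" where
  "affine_ifs m A u \<longleftrightarrow>
     0 < m \<and> (\<forall>i<m. invertible (A i)) \<and>
     (\<exists>N. is_norm N \<and>
        (\<forall>i<m. \<exists>c<1. \<forall>x y. N (affine_map A u i x - affine_map A u i y) \<le> c * N (x - y)))"

definition irreducible_ifs :: "nat \<Rightarrow> (nat \<Rightarrow> real^'n^'n) \<Rightarrow> bool" where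
  "irreducible_ifs m A \<longleftrightarrow>
     (\<forall>V. subspace V \<and> (\<forall>i<m. (\<lambda>x. A i *v x) ` V \<subseteq> V) \<longrightarrow> V = {0} \<or> V = UNIV)"

definition attractor :: "nat \<Rightarrow> (nat \<Rightarrow> real^'n^'n) \<Rightarrow> (nat \<Rightarrow> real^'n) \<Rightarrow> (real^'n) set" where
  "attractor m A u = (THE X. X \<noteq> {} \<and> compact X \<and> X = (\<Union>i<m. affine_map A u i ` X))"

definition codes :: "nat \<Rightarrow> (nat \<Rightarrow> nat) set" where
  "codes m = {s. \<forall>k. s k < m}"

text \<open>
  \<open>word_map A u s n\<close> is \<open>T\<^bsub>s 0\<^esub> \<circ> T\<^bsub>s 1\<^esub> \<circ> \<dots> \<circ> T\<^bsub>s (n-1)\<^esub>\<close>; sequences are indexed from \<open>0\<close>.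
\<close>

primrec word_map ::
  "(nat \<Rightarrow> real^'n^'n) \<Rightarrow> (nat \<Rightarrow> real^'n) \<Rightarrow> (nat \<Rightarrow> nat) \<Rightarrow> nat \<Rightarrow> real^'n \<Rightarrow> real^'n" where
  "word_map A u s 0 = id"
| "word_map A u s (Suc n) = word_map A u s n \<circ> affine_map A u (s n)"

text \<open>The limit does not depend on the base point, for which \<open>0\<close> is chosen.\<close>

definition coding_map ::
  "(nat \<Rightarrow> real^'n^'n) \<Rightarrow> (nat \<Rightarrow> real^'n) \<Rightarrow> (nat \<Rightarrow> nat) \<Rightarrow> real^'n" where
  "coding_map A u s = lim (\<lambda>n. word_map A u s n 0)"

definition shift :: "(nat \<Rightarrow> nat) \<Rightarrow> nat \<Rightarrow> nat" where
  "shift s = (\<lambda>k. s (Suc k))"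

text \<open>
  The topology on \<open>nat \<Rightarrow> nat\<close> is the product of the discrete topologies, so the restriction of
  \<open>borel\<close> to \<open>codes m\<close> is the Borel sigma-algebra of the sequence space.
\<close>

definition shift_invariant_prob :: "nat \<Rightarrow> (nat \<Rightarrow> nat) measure \<Rightarrow> bool" where
  "shift_invariant_prob m \<mu> \<longleftrightarrow>
     prob_space \<mu> \<and> space \<mu> = codes m \<and> sets \<mu> = sets (restrict_space borel (codes m)) \<and>
     (\<forall>E\<in>sets \<mu>. measure \<mu> (shift -` E \<inter> space \<mu>) = measure \<mu> E)"

definition ergodic_prob :: "nat \<Rightarrow> (nat \<Rightarrow> nat) measure \<Rightarrow> bool" where
  "ergodic_prob m \<mu> \<longleftrightarrow>
     shift_invariant_prob m \<mu> \<and>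
     (\<forall>E\<in>sets \<mu>. shift -` E \<inter> space \<mu> = E \<longrightarrow> measure \<mu> E = 0 \<or> measure \<mu> E = 1)"

definition coding_measure ::
  "(nat \<Rightarrow> real^'n^'n) \<Rightarrow> (nat \<Rightarrow> real^'n) \<Rightarrow> (nat \<Rightarrow> nat) measure \<Rightarrow> (real^'n) measure" where
  "coding_measure A u \<mu> = distr \<mu> borel (coding_map A u)"

text \<open>
  Hausdorff measure and dimension. Boundedness of the covering sets is required because
  \<open>diameter\<close> is meaningful only for bounded sets. The dimension only involves exponents \<open>s > 0\<close>,
  so the convention \<open>0 powr 0 = 0\<close> plays no role.
\<close>

definition hausdorff_premeasure :: "real \<Rightarrow> real \<Rightarrow> 'a::metric_space set \<Rightarrow> ennreal" where
  "hausdorff_premeasure s \<delta> E =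
     (INF U \<in> {U :: nat \<Rightarrow> 'a set. E \<subseteq> (\<Union>i. U i) \<and> (\<forall>i. bounded (U i) \<and> diameter (U i) \<le> \<delta>)}.
        \<Sum>i. ennreal (diameter (U i) powr s))"

definition hausdorff_measure :: "real \<Rightarrow> 'a::metric_space set \<Rightarrow> ennreal" where
  "hausdorff_measure s E = (SUP \<delta> \<in> {0<..}. hausdorff_premeasure s \<delta> E)"

definition hausdorff_dimension :: "'a::metric_space set \<Rightarrow> ereal" where
  "hausdorff_dimension E = (INF s \<in> {s. 0 < s \<and> hausdorff_measure s E = 0}. ereal s)"

text \<open>
  The local dimensions are meaningful only at points of the support of \<open>\<nu>\<close>, where all the balls
  have positive mass. For a Borel probability measure on a separable space the support has full
  measure, so nothing is lost in the almost everywhere statements below.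
\<close>

definition upper_local_dim :: "'a::metric_space measure \<Rightarrow> 'a \<Rightarrow> ereal" where
  "upper_local_dim \<nu> x =
     Limsup (at_right 0) (\<lambda>r. ereal (ln (measure \<nu> (cball x r)) / ln r))"

definition lower_local_dim :: "'a::metric_space measure \<Rightarrow> 'a \<Rightarrow> ereal" where
  "lower_local_dim \<nu> x =
     Liminf (at_right 0) (\<lambda>r. ereal (ln (measure \<nu> (cball x r)) / ln r))"

definition has_dimension :: "'a::metric_space measure \<Rightarrow> ereal \<Rightarrow> bool" where
  "has_dimension \<nu> a \<longleftrightarrow> (AE x in \<nu>. upper_local_dim \<nu> x = a \<and> lower_local_dim \<nu> x = a)"

definition exact_dimensional :: "'a::metric_space measure \<Rightarrow> bool" where
  "exact_dimensional \<nu> \<longleftrightarrow> (\<exists>a. has_dimension \<nu> a)"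

text \<open>
  Not necessarily orthogonal. The image measure on the range of \<open>Q\<close> is regarded as a measure on the
  ambient space; since balls of the range are traces of ambient balls with the same centre and
  radius, this does not change the local dimensions.
\<close>

definition proper_projection :: "(real^'n \<Rightarrow> real^'n) \<Rightarrow> bool" where
  "proper_projection Q \<longleftrightarrow> linear Q \<and> Q \<circ> Q = Q \<and> dim (range Q) < CARD('n)"

end

theory Submission
  imports Defs
begin

text \<open>
  The system has two maps, with linear parts \<open>D\<^sub>i P\<close>: \<open>P\<close> permutes the \<open>d\<close> coordinates cyclically and
  \<open>D\<^sub>i\<close> is diagonal. Its entry at one special coordinate is \<open>(1/5)\<^sup>2\<close> or \<open>(4/5)\<^sup>2\<close>, according to
  \<open>i\<close>, and all the other entries are \<open>(1/2)\<^sup>2\<close>. Along a code \<open>w\<close>, coordinate \<open>p\<close> (counted modulo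
  \<open>d\<close>) of the coded point is therefore given by a one-dimensional expansion: after \<open>n\<close>
  digits it is contracted by \<open>(q p w n)\<^sup>2\<close>, where \<open>q p w n\<close> is a product of \<open>n\<close> weights taken from
  \<open>(1/5, 4/5)\<close> whenever the phase \<open>p + k\<close> is divisible by \<open>d\<close> and from \<open>(1/2, 1/2)\<close> otherwise.
  The translations are chosen so that in every coordinate separately the two pieces stay apart.

  Because the weights sum to one at each phase, \<open>q p\<close> is the law on cylinders of a product measure
  \<open>\<nu> p\<close>. The shift turns \<open>\<nu> p\<close> into \<open>\<nu> (p + 1)\<close>, so the average \<open>\<mu>\<close> of \<open>\<nu> 0, \<dots>, \<nu> (d - 1)\<close> is
  invariant, and it is ergodic (\<open>ergodic_\<mu>\<close>) although none of the \<open>\<nu> p\<close> is invariant. A cylinder has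
  diameter comparable to \<open>max\<^sub>p (q p w n)\<^sup>2\<close> and mass comparable to \<open>max\<^sub>p q p w n\<close>; with the
  separation this makes the image of \<open>\<mu>\<close> Ahlfors regular of dimension \<open>1/2\<close>
  (\<open>measure_cball_lower\<close>, \<open>measure_cball_upper\<close>). Hence both this measure and the attractor have
  dimension \<open>1/2\<close>.

  If the image of another invariant measure \<open>M\<close> has dimension \<open>1/2\<close> too, then for \<open>M\<close>-almost all \<open>w\<close>
  the ratio \<open>M (cyl w n) / \<mu> (cyl w n)\<close> grows at most subexponentially. On the other hand, if \<open>M\<close> and
  \<open>\<mu>\<close> differed on a cylinder, a product of independent factors of mean one under every \<open>\<nu> p\<close>, built
  from the frequency of that cylinder, would have to grow exponentially on a set of positive
  \<open>M\<close>-measure, while its \<open>\<mu>\<close>-mean is one (\<open>unique_invariant\<close>).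

  Project onto the special coordinate. A ball around the projection of the coded point of \<open>w\<close> now
  corresponds to a cylinder with \<open>(q 0 w n)\<^sup>2\<close> comparable to its radius. For \<open>\<nu> 0\<close>-typical \<open>w\<close> the
  mass of the cylinder is \<open>q 0 w n\<close> up to subexponential factors, so the local dimension is \<open>1/2\<close>. For
  \<open>\<nu> 1\<close>-typical \<open>w\<close> the mass is at least \<open>q 1 w n / d\<close>, which exceeds \<open>q 0 w n\<close> by an exponential factor,
  and the local dimension is smaller. Both kinds of points have \<open>\<mu>\<close>-measure at least \<open>1/d\<close>, so no
  single value can be the dimension (\<open>not_has_dimension_ge_half\<close>, \<open>not_has_dimension_less_half\<close>).
\<close>

section \<open>Binary codes, cylinders and words\<close>

lemma shift_case_nat [simp]: "shift (case_nat i w) = w"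
  by (simp add: shift_def)

lemma case_nat_shift: "case_nat (w 0) (shift w) = w"
  by (rule ext) (simp add: shift_def split: nat.split)

lemma shift_pow: "(shift ^^ n) w k = w (n + k)"
  by (induction n arbitrary: w k) (auto simp: shift_def)

lemma codes_case_nat [simp]: "case_nat i w \<in> codes 2 \<longleftrightarrow> i < 2 \<and> w \<in> codes 2"
proof -
  have "(\<forall>k. P k) \<longleftrightarrow> P 0 \<and> (\<forall>k. P (Suc k))" for P :: "nat \<Rightarrow> bool"
    by (metis not0_implies_Suc)
  from this[of "\<lambda>k. case_nat i w k < 2"] show ?thesis by (simp add: codes_def)
qed

lemma codes_shift_pow: "w \<in> codes m \<Longrightarrow> (shift ^^ n) w \<in> codes m"
  by (simp add: codes_def shift_pow)

lemma codes_shift: "w \<in> codes m \<Longrightarrow> shift w \<in> codes m"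
  by (simp add: codes_def shift_def)

definition cyl :: "(nat \<Rightarrow> nat) \<Rightarrow> nat \<Rightarrow> (nat \<Rightarrow> nat) set" where
  "cyl w n = {w' \<in> codes 2. \<forall>k<n. w' k = w k}"

text \<open>
  Words of length \<open>n\<close> are represented by the codes that vanish from position \<open>n\<close> on, so that every
  function of codes can be evaluated at a word.
\<close>

primrec words :: "nat \<Rightarrow> (nat \<Rightarrow> nat) set" where
  "words 0 = {\<lambda>_. 0}"
| "words (Suc n) = (\<lambda>(i, w). case_nat i w) ` ({..<2} \<times> words n)"

lemma all_less_Suc_split: "(\<forall>k<Suc n. P k) \<longleftrightarrow> P 0 \<and> (\<forall>k<n. P (Suc k))"
  using less_Suc_eq_0_disj by auto

lemma finite_words: "finite (words n)"
  by (induction n) auto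

lemma words_codes: "w \<in> words n \<Longrightarrow> w \<in> codes 2"
proof (induction n arbitrary: w)
  case 0 then show ?case by (simp add: codes_def)
next
  case (Suc n) then show ?case by auto
qed

lemma sum_words_Suc:
  "(\<Sum>w\<in>words (Suc n). f w) = (\<Sum>i<2. \<Sum>w\<in>words n. f (case_nat i w))"
proof -
  have "inj_on (\<lambda>(i, w). case_nat i w) ({..<2::nat} \<times> words n)"
    by (rule inj_onI) (auto dest: fun_cong[of _ _ 0] arg_cong[of _ _ shift])
  then show ?thesis
    by (simp add: sum.reindex sum.cartesian_product case_prod_unfold)
qed

lemma ex1_word:
  assumes "w \<in> codes 2"
  shows "\<exists>!u. u \<in> words n \<and> w \<in> cyl u n"
  using assms
proof (induction n arbitrary: w)
  case 0 then show ?case by (simp add: cyl_def)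
next
  case (Suc n)
  have "shift w \<in> codes 2" using Suc.prems by (rule codes_shift)
  from Suc.IH[OF this] obtain u where u: "u \<in> words n" "shift w \<in> cyl u n"
    and uniq: "\<And>u'. u' \<in> words n \<Longrightarrow> shift w \<in> cyl u' n \<Longrightarrow> u' = u" by (elim ex1E) blast
  have w0: "w 0 < 2" using Suc.prems by (simp add: codes_def)
  show ?case
  proof (rule ex1I[of _ "case_nat (w 0) u"])
    show "case_nat (w 0) u \<in> words (Suc n) \<and> w \<in> cyl (case_nat (w 0) u) (Suc n)"
      using u w0 Suc.prems by (auto simp: cyl_def all_less_Suc_split shift_def)
  next
    fix u' assume u': "u' \<in> words (Suc n) \<and> w \<in> cyl u' (Suc n)"
    then obtain i v where iv: "u' = case_nat i v" "v \<in> words n" by auto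
    have "w 0 = i" "shift w \<in> cyl v n"
      using u' iv(1) codes_shift[of w 2] by (auto simp: cyl_def all_less_Suc_split shift_def)
    then show "u' = case_nat (w 0) u" using uniq iv by simp
  qed
qed

definition depends_on :: "nat \<Rightarrow> ((nat \<Rightarrow> nat) \<Rightarrow> 'b) \<Rightarrow> bool" where
  "depends_on n g \<longleftrightarrow> (\<forall>w\<in>codes 2. \<forall>w'\<in>codes 2. (\<forall>k<n. w k = w' k) \<longrightarrow> g w = g w')"

lemma depends_onD: "depends_on n g \<Longrightarrow> w \<in> codes 2 \<Longrightarrow> w' \<in> cyl w n \<Longrightarrow> g w' = g w"
  unfolding depends_on_def cyl_def by blast

lemma depends_on_compose: "depends_on n g \<Longrightarrow> depends_on n (\<lambda>w. h (g w))"
  unfolding depends_on_def by metis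

lemma depends_on_shift_pow:
  assumes "depends_on n g"
  shows "depends_on (k + n) (\<lambda>w. g ((shift ^^ k) w))"
  unfolding depends_on_def
proof (intro ballI impI)
  fix w w' assume "w \<in> codes 2" "w' \<in> codes 2" "\<forall>i<k + n. w i = w' i"
  then show "g ((shift ^^ k) w) = g ((shift ^^ k) w')"
    using depends_onD[OF assms, of "(shift ^^ k) w'" "(shift ^^ k) w"] codes_shift_pow
    by (simp add: cyl_def shift_pow)
qed

lemma depends_on_mono: "depends_on n g \<Longrightarrow> n \<le> m \<Longrightarrow> depends_on m g"
  unfolding depends_on_def by (meson order_less_le_trans)

lemma depends_on_sum:
  "(\<And>i. i \<in> I \<Longrightarrow> depends_on n (g i)) \<Longrightarrow> depends_on n (\<lambda>w. \<Sum>i\<in>I. g i w)"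
  unfolding depends_on_def by (intro ballI impI sum.cong) blast+

lemma depends_on_prod:
  "(\<And>i. i \<in> I \<Longrightarrow> depends_on n (g i)) \<Longrightarrow> depends_on n (\<lambda>w. \<Prod>i\<in>I. g i w)"
  unfolding depends_on_def by (intro ballI impI prod.cong) blast+

lemma depends_on_cyl: "depends_on n (\<lambda>w. indicator (cyl u n) w)"
  unfolding depends_on_def by (intro ballI impI) (simp add: indicator_def cyl_def)

lemma cyl_eqI: "(\<And>k. k < n \<Longrightarrow> w k = w' k) \<Longrightarrow> cyl w n = cyl w' n"
  by (auto simp: cyl_def)

lemma depends_on_cyl_center: "depends_on n (\<lambda>w. h (cyl w n))"
  unfolding depends_on_def
proof (intro ballI impI)
  fix w w' :: "nat \<Rightarrow> nat" assume "\<forall>k<n. w k = w' k"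
  then have "cyl w n = cyl w' n" by (intro cyl_eqI) simp
  then show "h (cyl w n) = h (cyl w' n)" by simp
qed

lemma depends_on_compose2:
  "depends_on n g \<Longrightarrow> depends_on n g' \<Longrightarrow> depends_on n (\<lambda>w. h (g w) (g' w))"
  unfolding depends_on_def by metis

text \<open>
  Together with the next lemmas on integrals, this reduces statements about such functions to finite
  sums over words.
\<close>

lemma depends_on_eq_sum:
  fixes g :: "(nat \<Rightarrow> nat) \<Rightarrow> 'b::semiring_1"
  assumes "depends_on n g" "w \<in> codes 2"
  shows "g w = (\<Sum>u\<in>words n. g u * indicator (cyl u n) w)"
proof -
  obtain u where u: "u \<in> words n" "w \<in> cyl u n"
    and uniq: "\<And>u'. u' \<in> words n \<Longrightarrow> w \<in> cyl u' n \<Longrightarrow> u' = u"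
    using ex1_word[OF assms(2), of n] by (elim ex1E) blast
  have "(\<Sum>u\<in>words n. g u * indicator (cyl u n) w) = (\<Sum>u'\<in>words n. if u' = u then g u else 0)"
  proof (rule sum.cong[OF refl])
    fix u' assume "u' \<in> words n"
    then show "g u' * indicator (cyl u' n) w = (if u' = u then g u else 0)"
      using u(2) uniq[of u'] by (cases "w \<in> cyl u' n") auto
  qed
  also have "\<dots> = g u" using u finite_words by simp
  also have "g u = g w" using depends_onD[OF assms(1) words_codes[OF u(1)] u(2)] by simp
  finally show ?thesis by simp
qed

definition code_space :: "(nat \<Rightarrow> nat) measure" where
  "code_space = restrict_space borel (codes 2)"

lemma space_code_space [simp]: "space code_space = codes 2"
  by (simp add: code_space_def space_restrict_space)

lemma measurable_digit [measurable]: "(\<lambda>w. w k) \<in> measurable code_space (count_space UNIV)"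
proof -
  have "(\<lambda>w. w k) \<in> borel_measurable (borel :: (nat \<Rightarrow> nat) measure)"
    by (rule measurable_product_coordinates)
  then have "(\<lambda>w. w k) \<in> measurable code_space (borel :: nat measure)"
    unfolding code_space_def by (rule measurable_restrict_space1)
  then show ?thesis
    by (simp add: measurable_cong_sets[OF refl sets_borel_eq_count_space])
qed

lemma measurable_into_code_space:
  assumes "\<And>k. (\<lambda>x. f x k) \<in> measurable M (count_space UNIV)" "\<And>x. x \<in> space M \<Longrightarrow> f x \<in> codes 2"
  shows "f \<in> measurable M code_space"
  unfolding code_space_def
proof (rule measurable_restrict_space2)
  show "f \<in> borel_measurable M"
    by (rule measurable_coordinatewise_then_product) (use assms(1) in \<open>simp add: measurable_cong_sets[OF refl sets_borel_eq_count_space]\<close>)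
qed (use assms(2) in auto)

lemma measurable_shift [measurable]: "shift \<in> measurable code_space code_space"
  by (rule measurable_into_code_space) (auto simp: shift_def codes_def)

lemma measurable_shift_pow [measurable]: "(shift ^^ n) \<in> measurable code_space code_space"
  by (rule measurable_into_code_space) (auto simp: shift_pow codes_def)

lemma measurable_case_nat_code [measurable]:
  "i < 2 \<Longrightarrow> case_nat i \<in> measurable code_space code_space"
  by (rule measurable_into_code_space) (auto split: nat.split)

lemma cyl_eq_INT: "cyl w n = {w' \<in> space code_space. \<forall>k\<in>{..<n}. w' k = w k}"
  by (auto simp: cyl_def)

lemma sets_cyl [measurable]: "cyl w n \<in> sets code_space"
  unfolding cyl_eq_INT by measurable

lemma cyl_sub: "cyl w n \<subseteq> codes 2"
  by (auto simp: cyl_def)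

lemma sets_code_space: "sets code_space = sigma_sets (codes 2) (range (\<lambda>(w, n). cyl w n))"
    (is "_ = sigma_sets _ ?G")
proof
  have G: "?G \<subseteq> Pow (codes 2)" using cyl_sub by auto
  show "sigma_sets (codes 2) ?G \<subseteq> sets code_space"
    using sets.sigma_sets_subset[of ?G code_space] sets_cyl
    by (metis (mono_tags, lifting) case_prod_unfold image_subsetI space_code_space)
  have dig: "(\<lambda>w. w k) \<in> measurable (sigma (codes 2) ?G) (count_space UNIV)" for k
  proof (rule measurableI)
    fix A :: "nat set"
    have "(\<lambda>w. w k) -` A \<inter> codes 2 = (\<Union>u\<in>{u\<in>words (Suc k). u k \<in> A}. cyl u (Suc k))"
      using ex1_word[of _ "Suc k"] by (fastforce simp: cyl_def)
    moreover have "\<dots> \<in> sets (sigma (codes 2) ?G)"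
      using G finite_words by (intro sets.finite_UN) (auto intro!: sigma_sets.Basic)
    ultimately show "(\<lambda>w. w k) -` A \<inter> space (sigma (codes 2) ?G) \<in> sets (sigma (codes 2) ?G)"
      using G by simp
  qed simp
  have "(\<lambda>w. w) \<in> measurable (sigma (codes 2) ?G) code_space"
    by (rule measurable_into_code_space) (use dig G in auto)
  from measurable_sets[OF this] G show "sets code_space \<subseteq> sigma_sets (codes 2) ?G"
    by (auto simp: subset_iff) (metis Int_absorb2 sets.sets_into_space space_code_space)
qed

lemma cyl_0: "cyl w 0 = codes 2" by (auto simp: cyl_def)

text \<open>
  The cylinders form a generator stable under intersections: two of them are either disjoint or nested.
\<close>

lemma code_measure_eqI:
  assumes "finite_measure M" "sets M = sets code_space" "sets N = sets code_space"
    and "\<And>w n. emeasure M (cyl w n) = emeasure N (cyl w n)"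
  shows "M = N"
proof (rule measure_eqI_generator_eq)
  show "Int_stable (range (\<lambda>(w, n). cyl w n))"
  proof (rule Int_stableI, clarify)
    fix w1 w2 :: "nat \<Rightarrow> nat" and n1 n2
    show "cyl w1 n1 \<inter> cyl w2 n2 \<in> range (\<lambda>(w, n). cyl w n)"
    proof (cases "cyl w1 n1 \<inter> cyl w2 n2 = {}")
      case True
      have "cyl (\<lambda>_. 2) 1 = {}" by (auto simp: cyl_def codes_def) (metis less_irrefl)
      then show ?thesis unfolding True by (auto intro!: image_eqI[of _ _ "(\<lambda>_. 2, 1)"])
    next
      case False
      then obtain v where "v \<in> cyl w1 n1" "v \<in> cyl w2 n2" by auto
      then have v: "\<And>k. k < n1 \<Longrightarrow> v k = w1 k" "\<And>k. k < n2 \<Longrightarrow> v k = w2 k"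
        by (auto simp: cyl_def)
      have "cyl w1 n1 \<inter> cyl w2 n2 = cyl v (max n1 n2)"
        unfolding cyl_def by (auto simp: less_max_iff_disj v)
      then show ?thesis by auto
    qed
  qed
  show "range (\<lambda>(w, n). cyl w n) \<subseteq> Pow (codes 2)" using cyl_sub by auto
  show "\<And>X. X \<in> range (\<lambda>(w, n). cyl w n) \<Longrightarrow> emeasure M X = emeasure N X"
    using assms(4) by auto
  show "sets M = sigma_sets (codes 2) (range (\<lambda>(w, n). cyl w n))"
    "sets N = sigma_sets (codes 2) (range (\<lambda>(w, n). cyl w n))"
    using assms(2,3) sets_code_space by auto
  show "range (\<lambda>_::nat. codes 2) \<subseteq> range (\<lambda>(w, n). cyl w n)" using cyl_0 by auto
  show "(\<Union>i::nat. codes 2) = codes 2" by simp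
  show "\<And>i. emeasure M (codes 2) \<noteq> \<infinity>"
    using assms(1) by (simp add: finite_measure.emeasure_finite)
qed

lemma depends_on_measurable:
  fixes g :: "(nat \<Rightarrow> nat) \<Rightarrow> 'b::topological_space"
  assumes "depends_on n g"
  shows "g \<in> borel_measurable code_space"
proof (rule measurableI)
  fix A :: "'b set"
  have "g -` A \<inter> space code_space = (\<Union>u\<in>{u\<in>words n. g u \<in> A}. cyl u n)"
  proof (intro equalityI subsetI)
    fix w assume w: "w \<in> g -` A \<inter> space code_space"
    then obtain u where "u \<in> words n" "w \<in> cyl u n" using ex1_word[of w n] by auto
    then show "w \<in> (\<Union>u\<in>{u\<in>words n. g u \<in> A}. cyl u n)"
      using depends_onD[OF assms words_codes] w by (intro UN_I[of u]) auto
  next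
    fix w assume "w \<in> (\<Union>u\<in>{u\<in>words n. g u \<in> A}. cyl u n)"
    then show "w \<in> g -` A \<inter> space code_space"
      using depends_onD[OF assms words_codes] cyl_sub by fastforce
  qed
  also have "\<dots> \<in> sets code_space" using finite_words by (intro sets.finite_UN) auto
  finally show "g -` A \<inter> space code_space \<in> sets code_space" .
qed simp

lemma depends_on_sets:
  assumes "depends_on n P"
  shows "{w\<in>codes 2. P w} \<in> sets code_space"
proof -
  have "(P -` {True} \<inter> space code_space) \<in> sets code_space"
    using depends_on_measurable[OF assms] by (rule measurable_sets) simp
  moreover have "P -` {True} \<inter> space code_space = {w\<in>codes 2. P w}" by auto
  ultimately show ?thesis by simp
qed

lemma nn_integral_words:
  assumes "sets M = sets code_space" "depends_on n g"
  shows "(\<integral>\<^sup>+w. g w \<partial>M) = (\<Sum>u\<in>words n. g u * emeasure M (cyl u n))"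
proof -
  have sp: "space M = codes 2" using sets_eq_imp_space_eq[OF assms(1)] by simp
  have "(\<integral>\<^sup>+w. g w \<partial>M) = (\<integral>\<^sup>+w. (\<Sum>u\<in>words n. g u * indicator (cyl u n) w) \<partial>M)"
    using depends_on_eq_sum[OF assms(2)] sp by (intro nn_integral_cong) auto
  also have "\<dots> = (\<Sum>u\<in>words n. g u * emeasure M (cyl u n))"
  proof (subst nn_integral_sum)
    have [measurable]: "cyl u n \<in> sets M" for u using assms(1) by simp
    show "(\<lambda>w. g u * indicator (cyl u n) w) \<in> borel_measurable M" for u by measurable
    show "(\<Sum>u\<in>words n. \<integral>\<^sup>+w. g u * indicator (cyl u n) w \<partial>M)
        = (\<Sum>u\<in>words n. g u * emeasure M (cyl u n))"
      by (intro sum.cong nn_integral_cmult_indicator) auto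
  qed
  finally show ?thesis .
qed

lemma emeasure_words:
  assumes "sets M = sets code_space" "depends_on n P"
  shows "emeasure M {w\<in>codes 2. P w} = (\<Sum>u\<in>{u\<in>words n. P u}. emeasure M (cyl u n))"
proof -
  have d: "depends_on n (indicator {w. P w} :: _ \<Rightarrow> ennreal)"
    using depends_on_compose[OF assms(2), of "\<lambda>b. if b then 1 else 0"]
    by (simp add: indicator_def[abs_def] of_bool_def)
  have sp: "space M = codes 2" using sets_eq_imp_space_eq[OF assms(1)] by simp
  have ms: "{w\<in>codes 2. P w} \<in> sets M" using depends_on_sets[OF assms(2)] assms(1) by simp
  have "emeasure M {w\<in>codes 2. P w} = (\<integral>\<^sup>+w. indicator {w. P w} w \<partial>M)"
    using sp by (subst nn_integral_indicator[OF ms, symmetric]) (auto intro!: nn_integral_cong simp: indicator_def)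
  also have "\<dots> = (\<Sum>u\<in>words n. indicator {w. P w} u * emeasure M (cyl u n))"
    by (rule nn_integral_words[OF assms(1) d])
  also have "\<dots> = (\<Sum>u\<in>{u\<in>words n. P u}. emeasure M (cyl u n))"
    using finite_words by (intro sum.mono_neutral_cong_right) (auto simp: indicator_def)
  finally show ?thesis .
qed

section \<open>The phased Bernoulli measures and their average\<close>

locale phases =
  fixes d :: nat
  assumes two_le_d: "2 \<le> d"
begin

text \<open>
  The square of \<open>wt p i\<close> will be the ratio by which the map of digit \<open>i\<close> contracts a coordinate of
  phase \<open>p\<close>. The weights of a phase sum to one, which makes \<open>1/2\<close> the similarity dimension. Digits
  other than 0 and 1 get weight 0, so that \<open>q p w n\<close> is the mass of \<open>cyl w n\<close> for arbitrary sequences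
  \<open>w\<close>, the cylinder being empty when \<open>w\<close> has an illegal digit before position \<open>n\<close>.
\<close>

definition wt :: "nat \<Rightarrow> nat \<Rightarrow> real" where
  "wt p i = (if i = 0 then (if d dvd p then 1/5 else 1/2)
             else if i = 1 then (if d dvd p then 4/5 else 1/2) else 0)"

definition q :: "nat \<Rightarrow> (nat \<Rightarrow> nat) \<Rightarrow> nat \<Rightarrow> real" where
  "q p w n = (\<Prod>k<n. wt (p + k) (w k))"

lemma d_pos: "0 < d" using two_le_d by simp

lemma wt_nonneg: "0 \<le> wt p i" by (simp add: wt_def)
lemma wt_ge: "i < 2 \<Longrightarrow> 1/5 \<le> wt p i" by (auto simp: wt_def)
lemma wt_pos: "i < 2 \<Longrightarrow> 0 < wt p i" by (auto simp: wt_def)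
lemma wt_le: "wt p i \<le> 4/5" by (simp add: wt_def)
lemma sum_wt: "(\<Sum>i<2. wt p i) = 1" by (simp add: wt_def numeral_2_eq_2)
lemma wt_add_d: "wt (p + d) i = wt p i" by (simp add: wt_def)
lemma wt_mod: "wt (p mod d) i = wt p i" by (simp add: wt_def dvd_mod_iff)

lemma q_0 [simp]: "q p w 0 = 1" by (simp add: q_def)
lemma q_Suc: "q p w (Suc n) = q p w n * wt (p + n) (w n)" by (simp add: q_def)
lemma q_case_nat: "q p (case_nat i w) (Suc n) = wt p i * q (Suc p) w n"
  unfolding q_def by (subst prod.lessThan_Suc_shift) simp
lemma q_nonneg: "0 \<le> q p w n" by (simp add: q_def prod_nonneg wt_nonneg)
lemma q_pos: "w \<in> codes 2 \<Longrightarrow> 0 < q p w n"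
  by (auto simp: q_def codes_def intro!: prod_pos wt_pos)
lemma q_le: "q p w n \<le> (4/5) ^ n"
proof -
  have "q p w n \<le> (\<Prod>k<n. 4/5)" unfolding q_def by (rule prod_mono) (blast intro: wt_nonneg wt_le)
  then show ?thesis by simp
qed
lemma q_ge: "w \<in> codes 2 \<Longrightarrow> (1/5) ^ n \<le> q p w n"
proof -
  assume "w \<in> codes 2"
  then have "(\<Prod>k<n. 1/5) \<le> q p w n"
    unfolding q_def codes_def by (intro prod_mono conjI wt_ge) auto
  then show ?thesis by simp
qed
lemma q_mod: "q (p mod d) w n = q p w n"
proof -
  have "wt (p mod d + k) i = wt (p + k) i" for k i
    by (metis mod_add_left_eq wt_mod)
  then show ?thesis by (simp add: q_def)
qed
lemma q_cong: "(\<And>k. k < n \<Longrightarrow> w k = w' k) \<Longrightarrow> q p w n = q p w' n"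
  by (simp add: q_def)
lemma q_cyl: "w' \<in> cyl w n \<Longrightarrow> q p w' n = q p w n"
  by (intro q_cong) (simp add: cyl_def)

definition coin :: "nat \<Rightarrow> bool pmf" where "coin p = bernoulli_pmf (wt p 1)"

definition \<nu> :: "nat \<Rightarrow> (nat \<Rightarrow> nat) measure" where
  "\<nu> p = distr (PiM UNIV (\<lambda>k. measure_pmf (coin (p + k)))) code_space (\<lambda>s k. of_bool (s k))"

lemma sets_\<nu> [simp, measurable_cong]: "sets (\<nu> p) = sets code_space" by (simp add: \<nu>_def)
lemma space_\<nu> [simp]: "space (\<nu> p) = codes 2" by (simp add: \<nu>_def)

lemma emeasure_coin: "emeasure (measure_pmf (coin p)) {b. of_bool b = i} = wt p i"
proof -
  have "{b. of_bool b = i} = (if i = 0 then {False} else if i = 1 then {True} else {})"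
    by (auto split: if_splits)
  then show ?thesis by (auto simp: emeasure_pmf_single coin_def wt_def)
qed

lemma measurable_bits:
  "(\<lambda>s k. of_bool (s k)) \<in> measurable (PiM UNIV (\<lambda>k. measure_pmf (coin (p + k)))) code_space"
proof (rule measurable_into_code_space)
  fix k
  have "(\<lambda>s. s k) \<in> measurable (PiM UNIV (\<lambda>k. measure_pmf (coin (p + k)))) (measure_pmf (coin (p + k)))"
    by (rule measurable_component_singleton) simp
  then show "(\<lambda>s. of_bool (s k)) \<in> measurable (PiM UNIV (\<lambda>k. measure_pmf (coin (p + k)))) (count_space UNIV)"
    by (rule measurable_compose) simp
qed (auto simp: codes_def)

lemma emeasure_\<nu>_cyl: "emeasure (\<nu> p) (cyl w n) = q p w n"
proof -
  interpret product_prob_space "\<lambda>k. measure_pmf (coin (p + k))" UNIV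
    by unfold_locales
  let ?P = "PiM UNIV (\<lambda>k. measure_pmf (coin (p + k)))"
  have "emeasure (\<nu> p) (cyl w n) = emeasure ?P ((\<lambda>s k. of_bool (s k)) -` cyl w n \<inter> space ?P)"
    unfolding \<nu>_def by (rule emeasure_distr[OF measurable_bits sets_cyl])
  also have "(\<lambda>s k. of_bool (s k)) -` cyl w n \<inter> space ?P
      = prod_emb UNIV (\<lambda>k. measure_pmf (coin (p + k))) {..<n} (Pi\<^sub>E {..<n} (\<lambda>k. {b. of_bool b = w k}))"
  proof (rule set_eqI)
    fix s :: "nat \<Rightarrow> bool"
    have "of_bool (s k) < (2::nat)" for k by simp
    then show "s \<in> (\<lambda>s k. of_bool (s k)) -` cyl w n \<inter> space ?P \<longleftrightarrow>
        s \<in> prod_emb UNIV (\<lambda>k. measure_pmf (coin (p + k))) {..<n} (Pi\<^sub>E {..<n} (\<lambda>k. {b. of_bool b = w k}))"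
      unfolding cyl_def codes_def prod_emb_def space_PiM vimage_def Int_iff mem_Collect_eq restrict_PiE_iff
      by (simp del: of_bool_eq_iff) auto
  qed
  also have "emeasure ?P \<dots> = (\<Prod>k<n. emeasure (measure_pmf (coin (p + k))) {b. of_bool b = w k})"
    by (rule emeasure_PiM_emb) auto
  also have "\<dots> = (\<Prod>k<n. ennreal (wt (p + k) (w k)))" by (simp add: emeasure_coin)
  also have "\<dots> = q p w n" unfolding q_def by (rule prod_ennreal) (simp add: wt_nonneg)
  finally show ?thesis .
qed

lemma prob_space_\<nu>: "prob_space (\<nu> p)"
proof
  show "emeasure (\<nu> p) (space (\<nu> p)) = 1"
    using emeasure_\<nu>_cyl[of p undefined 0] by (simp add: cyl_0)
qed

lemma measure_\<nu>_cyl: "measure (\<nu> p) (cyl w n) = q p w n"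
  by (simp add: measure_def emeasure_\<nu>_cyl q_nonneg)

definition prepend_coin :: "nat \<Rightarrow> bool \<Rightarrow> (nat \<Rightarrow> nat) measure" where
  "prepend_coin p b = distr (\<nu> (Suc p)) code_space (case_nat (of_bool b))"

lemma measurable_prepend: "case_nat (of_bool b) \<in> measurable (\<nu> p) code_space"
  by (simp add: measurable_cong_sets[OF sets_\<nu> refl])

lemma prepend_kernel:
  "prepend_coin p \<in> measurable (measure_pmf (coin p)) (subprob_algebra code_space)"
proof -
  have "prepend_coin p b \<in> space (subprob_algebra code_space)" for b
    unfolding space_subprob_algebra prepend_coin_def
    using prob_space.prob_space_distr[OF prob_space_\<nu> measurable_prepend, of "Suc p" b]
    by (simp add: prob_space_imp_subprob_space)
  then show ?thesis by simp
qed

text \<open>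
  The disintegration of \<open>\<nu> p\<close> over the first digit; independence statements follow from it by
  induction on the number of digits.
\<close>

lemma \<nu>_unroll: "\<nu> p = measure_pmf (coin p) \<bind> prepend_coin p"
proof (rule code_measure_eqI)
  show "finite_measure (\<nu> p)" using prob_space_\<nu> by (rule prob_space.finite_measure)
  show "sets (\<nu> p) = sets code_space" by simp
  show "sets (measure_pmf (coin p) \<bind> prepend_coin p) = sets code_space" by (rule sets_bind) (auto simp: prepend_coin_def)
  fix w n
  have E: "emeasure (prepend_coin p b) (cyl w n) = (if n = 0 then 1 else if of_bool b = w 0 then ennreal (q (Suc p) (shift w) (n - 1)) else 0)" for b
  proof -
    have "emeasure (prepend_coin p b) (cyl w n) = emeasure (\<nu> (Suc p)) (case_nat (of_bool b) -` cyl w n \<inter> codes 2)"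
      unfolding prepend_coin_def by (subst emeasure_distr[OF measurable_prepend]) auto
    also have "case_nat (of_bool b) -` cyl w n \<inter> codes 2
       = (if n = 0 then codes 2 else if of_bool b = w 0 then cyl (shift w) (n - 1) else {})"
      by (cases n) (auto simp: cyl_def all_less_Suc_split shift_def)
    finally show ?thesis
      using prob_space.emeasure_space_1[OF prob_space_\<nu>[of "Suc p"]] by (simp add: emeasure_\<nu>_cyl)
  qed
  have "emeasure (measure_pmf (coin p) \<bind> prepend_coin p) (cyl w n) = (\<integral>\<^sup>+b. emeasure (prepend_coin p b) (cyl w n) \<partial>measure_pmf (coin p))"
    by (rule emeasure_bind[OF _ prepend_kernel]) auto
  also have "\<dots> = (if n = 0 then 1 else
      (\<integral>\<^sup>+b. ennreal (q (Suc p) (shift w) (n - 1)) * indicator {b. of_bool b = w 0} b \<partial>measure_pmf (coin p)))"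
    unfolding E by (cases "n = 0") (auto intro!: nn_integral_cong simp: measure_pmf.emeasure_space_1[simplified] indicator_def)
  also have "\<dots> = (if n = 0 then 1 else ennreal (q (Suc p) (shift w) (n - 1)) * ennreal (wt p (w 0)))"
    by (subst nn_integral_cmult_indicator) (auto simp: emeasure_coin)
  also have "\<dots> = q p w n"
  proof (cases n)
    case (Suc m)
    have "q p w (Suc m) = wt p (w 0) * q (Suc p) (shift w) m"
      using q_case_nat[of p "w 0" "shift w" m] by (simp add: case_nat_shift)
    then show ?thesis using Suc by (simp add: ennreal_mult[symmetric] q_nonneg wt_nonneg mult.commute)
  qed simp
  finally show "emeasure (\<nu> p) (cyl w n) = emeasure (measure_pmf (coin p) \<bind> prepend_coin p) (cyl w n)"
    by (simp add: emeasure_\<nu>_cyl)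
qed

lemma nn_integral_\<nu>_unroll:
  assumes [measurable]: "g \<in> borel_measurable code_space"
  shows "(\<integral>\<^sup>+w. g w \<partial>\<nu> p) = (\<Sum>i<2. wt p i * (\<integral>\<^sup>+w. g (case_nat i w) \<partial>\<nu> (Suc p)))"
proof -
  have "(\<integral>\<^sup>+w. g w \<partial>\<nu> p) = (\<integral>\<^sup>+b. (\<integral>\<^sup>+w. g w \<partial>prepend_coin p b) \<partial>measure_pmf (coin p))"
    by (subst \<nu>_unroll) (rule nn_integral_bind[OF assms prepend_kernel])
  also have "\<dots> = (\<integral>\<^sup>+b. (\<integral>\<^sup>+w. g (case_nat (of_bool b) w) \<partial>\<nu> (Suc p)) \<partial>measure_pmf (coin p))"
    unfolding prepend_coin_def by (intro nn_integral_cong nn_integral_distr measurable_prepend) (simp add: assms)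
  also have "\<dots> = (\<integral>\<^sup>+b. (\<integral>\<^sup>+w. g (case_nat (of_bool b) w) \<partial>\<nu> (Suc p)) \<partial>bernoulli_pmf (wt p 1))"
    by (simp add: coin_def)
  also have "\<dots> = (\<Sum>b\<in>UNIV. (\<integral>\<^sup>+w. g (case_nat (of_bool b) w) \<partial>\<nu> (Suc p)) * ennreal (pmf (bernoulli_pmf (wt p 1)) b))"
    by (rule nn_integral_measure_pmf_support) auto
  also have "\<dots> = (\<Sum>i<2. wt p i * (\<integral>\<^sup>+w. g (case_nat i w) \<partial>\<nu> (Suc p)))"
    by (simp add: UNIV_bool numeral_2_eq_2 mult.commute) (simp add: wt_def)
  finally show ?thesis .
qed

text \<open>
  Independence of the first \<open>n\<close> digits from the tail; passing to the tail advances the phase by \<open>n\<close>.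
\<close>

lemma nn_integral_\<nu>_split:
  fixes g :: "(nat \<Rightarrow> nat) \<Rightarrow> ennreal"
  assumes "depends_on n g" and h[measurable]: "h \<in> borel_measurable code_space"
  shows "(\<integral>\<^sup>+w. g w * h ((shift ^^ n) w) \<partial>\<nu> p) = (\<integral>\<^sup>+w. g w \<partial>\<nu> p) * (\<integral>\<^sup>+w. h w \<partial>\<nu> (p + n))"
  using assms(1)
proof (induction n arbitrary: p g)
  case 0
  have "g w = g (\<lambda>_. 0)" if "w \<in> codes 2" for w
    using depends_onD[OF 0, of "\<lambda>_. 0" w] that by (simp add: codes_def cyl_0)
  then have "(\<integral>\<^sup>+w. g w * h w \<partial>\<nu> p) = (\<integral>\<^sup>+w. g (\<lambda>_. 0) * h w \<partial>\<nu> p)"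
    "(\<integral>\<^sup>+w. g w \<partial>\<nu> p) = (\<integral>\<^sup>+w. g (\<lambda>_. 0) \<partial>\<nu> p)"
    by - (rule nn_integral_cong; simp only: space_\<nu>)+
  moreover have "(\<integral>\<^sup>+w. g (\<lambda>_. 0) \<partial>\<nu> p) = g (\<lambda>_. 0)"
    using prob_space.emeasure_space_1[OF prob_space_\<nu>[of p]] by simp
  ultimately show ?case by (simp add: nn_integral_cmult)
next
  case (Suc n)
  have dep: "depends_on n (\<lambda>w. g (case_nat i w))" if "i < 2" for i
    unfolding depends_on_def
  proof (intro ballI impI)
    fix w w' assume *: "w \<in> codes 2" "w' \<in> codes 2" "\<forall>k<n. w k = w' k"
    then have "\<forall>k<Suc n. case_nat i w k = case_nat i w' k" by (auto split: nat.split)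
    then show "g (case_nat i w) = g (case_nat i w')"
      using Suc.prems that * unfolding depends_on_def by (meson codes_case_nat)
  qed
  have [measurable]: "g \<in> borel_measurable code_space" using Suc.prems by (rule depends_on_measurable)
  have "(\<integral>\<^sup>+w. g w * h ((shift ^^ Suc n) w) \<partial>\<nu> p)
      = (\<Sum>i<2. wt p i * (\<integral>\<^sup>+w. g (case_nat i w) * h ((shift ^^ Suc n) (case_nat i w)) \<partial>\<nu> (Suc p)))"
    by (rule nn_integral_\<nu>_unroll) measurable
  also have "\<dots> = (\<Sum>i<2. wt p i * ((\<integral>\<^sup>+w. g (case_nat i w) \<partial>\<nu> (Suc p)) * (\<integral>\<^sup>+w. h w \<partial>\<nu> (p + Suc n))))"
    using Suc.IH[OF dep, of _ "Suc p"] by (intro sum.cong) (auto simp: funpow_Suc_right simp del: funpow.simps)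
  also have "\<dots> = (\<Sum>i<2. wt p i * (\<integral>\<^sup>+w. g (case_nat i w) \<partial>\<nu> (Suc p))) * (\<integral>\<^sup>+w. h w \<partial>\<nu> (p + Suc n))"
    by (simp add: sum_distrib_right mult.assoc)
  also have "(\<Sum>i<2. wt p i * (\<integral>\<^sup>+w. g (case_nat i w) \<partial>\<nu> (Suc p))) = (\<integral>\<^sup>+w. g w \<partial>\<nu> p)"
    by (rule nn_integral_\<nu>_unroll[symmetric]) measurable
  finally show ?case .
qed

lemma \<nu>_add_d: "\<nu> (p + d) = \<nu> p"
proof -
  have "coin (p + d + k) = coin (p + k)" for k
    using wt_add_d[of "p + k"] by (simp add: coin_def ac_simps)
  then show ?thesis unfolding \<nu>_def by simp
qed

lemma emeasure_\<nu>_shift_pow: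
  assumes E: "E \<in> sets code_space"
  shows "emeasure (\<nu> p) ((shift ^^ n) -` E \<inter> codes 2) = emeasure (\<nu> (p + n)) E"
proof -
  have m: "(shift ^^ n) -` E \<inter> codes 2 \<in> sets code_space"
    using measurable_sets[OF measurable_shift_pow E, of n] by simp
  have "emeasure (\<nu> p) ((shift ^^ n) -` E \<inter> codes 2) = (\<integral>\<^sup>+w. indicator ((shift ^^ n) -` E \<inter> codes 2) w \<partial>\<nu> p)"
    using m by simp
  also have "\<dots> = (\<integral>\<^sup>+w. 1 * indicator E ((shift ^^ n) w) \<partial>\<nu> p)"
    by (intro nn_integral_cong) (auto simp: indicator_def)
  also have "\<dots> = (\<integral>\<^sup>+w. 1 \<partial>\<nu> p) * (\<integral>\<^sup>+w. indicator E w \<partial>\<nu> (p + n))"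
    by (rule nn_integral_\<nu>_split) (use E in \<open>auto simp: depends_on_def\<close>)
  also have "\<dots> = emeasure (\<nu> (p + n)) E"
    using E prob_space.emeasure_space_1[OF prob_space_\<nu>[of p]] by simp
  finally show ?thesis .
qed

definition \<mu> :: "(nat \<Rightarrow> nat) measure" where
  "\<mu> = measure_pmf (pmf_of_set {..<d}) \<bind> \<nu>"

lemma \<nu>_kernel: "\<nu> \<in> measurable (measure_pmf (pmf_of_set {..<d})) (subprob_algebra code_space)"
proof -
  have "\<nu> p \<in> space (subprob_algebra code_space)" for p
    by (auto simp: space_subprob_algebra intro!: prob_space_imp_subprob_space prob_space_\<nu>)
  then show ?thesis by simp
qed

lemma sets_\<mu> [simp, measurable_cong]: "sets \<mu> = sets code_space"
  unfolding \<mu>_def by (rule sets_bind) auto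

lemma space_\<mu> [simp]: "space \<mu> = codes 2"
  using sets_eq_imp_space_eq[OF sets_\<mu>] by simp

lemma nn_integral_\<mu>:
  assumes "g \<in> borel_measurable code_space"
  shows "(\<integral>\<^sup>+w. g w \<partial>\<mu>) = (\<Sum>p<d. (\<integral>\<^sup>+w. g w \<partial>\<nu> p)) / of_nat d"
proof -
  have "(\<integral>\<^sup>+w. g w \<partial>\<mu>) = (\<integral>\<^sup>+p. (\<integral>\<^sup>+w. g w \<partial>\<nu> p) \<partial>measure_pmf (pmf_of_set {..<d}))"
    unfolding \<mu>_def by (rule nn_integral_bind[OF assms \<nu>_kernel])
  also have "\<dots> = (\<Sum>p<d. (\<integral>\<^sup>+w. g w \<partial>\<nu> p)) / card {..<d}"
    by (rule nn_integral_pmf_of_set) (use d_pos in \<open>auto simp: lessThan_empty_iff\<close>)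
  finally show ?thesis by (simp add: ennreal_of_nat_eq_real_of_nat)
qed

lemma emeasure_\<mu>:
  assumes "E \<in> sets code_space"
  shows "emeasure \<mu> E = (\<Sum>p<d. emeasure (\<nu> p) E) / of_nat d"
  using nn_integral_\<mu>[of "indicator E"] assms by simp

lemma prob_space_\<mu>: "prob_space \<mu>"
proof
  have "emeasure (\<nu> p) (codes 2) = 1" for p
    using prob_space.emeasure_space_1[OF prob_space_\<nu>[of p]] by simp
  then show "emeasure \<mu> (space \<mu>) = 1"
    using emeasure_\<mu>[of "codes 2"] d_pos sets.top[of code_space]
    by (simp add: ennreal_of_nat_eq_real_of_nat divide_ennreal)
qed

lemma measure_\<mu>:
  assumes "E \<in> sets code_space"
  shows "measure \<mu> E = (\<Sum>p<d. measure (\<nu> p) E) / d"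
proof -
  interpret prob_space \<mu> by (rule prob_space_\<mu>)
  have "emeasure (\<nu> p) E = measure (\<nu> p) E" for p
    using prob_space_\<nu>[of p] by (metis finite_measure.emeasure_eq_measure prob_space.finite_measure)
  then have "emeasure \<mu> E = ennreal ((\<Sum>p<d. measure (\<nu> p) E) / d)"
    using emeasure_\<mu>[OF assms] d_pos
    by (simp add: sum_ennreal divide_ennreal ennreal_of_nat_eq_real_of_nat sum_nonneg)
  then show ?thesis
    by (simp add: emeasure_eq_measure sum_nonneg)
qed

lemma measure_\<mu>_cyl: "measure \<mu> (cyl w n) = (\<Sum>p<d. q p w n) / d"
  by (simp add: measure_\<mu> measure_\<nu>_cyl)

text \<open>
  The phases matter only modulo \<open>d\<close>, so averages over a period do not change under the shift. This is
  what makes \<open>\<mu>\<close> invariant.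
\<close>

lemma sum_phase_shift:
  assumes "\<And>p. f (p + d) = f p"
  shows "(\<Sum>p<d. f (p + i)) = (\<Sum>p<d. f p :: real)"
proof (induction i)
  case (Suc i)
  have "(\<Sum>p<d. f (p + Suc i)) = (\<Sum>p<Suc d. f (p + i)) - f i"
    by (subst sum.lessThan_Suc_shift) simp
  also have "\<dots> = (\<Sum>p<d. f (p + i))" using assms[of i] by (simp add: add.commute)
  finally show ?case using Suc by simp
qed simp

lemma measure_\<nu>_shift_pow:
  assumes "E \<in> sets code_space"
  shows "measure (\<nu> p) ((shift ^^ n) -` E \<inter> codes 2) = measure (\<nu> (p + n)) E"
  using emeasure_\<nu>_shift_pow[OF assms] by (simp add: measure_def)

lemma shift_invariant_\<mu>: "shift_invariant_prob 2 \<mu>"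
  unfolding shift_invariant_prob_def
proof (intro conjI ballI)
  show "prob_space \<mu>" by (rule prob_space_\<mu>)
  show "space \<mu> = codes 2" by simp
  show "sets \<mu> = sets (restrict_space borel (codes 2))" using sets_\<mu> unfolding code_space_def .
  fix E assume "E \<in> sets \<mu>"
  then have E: "E \<in> sets code_space" by simp
  then have E': "shift -` E \<inter> codes 2 \<in> sets code_space"
    using measurable_sets[OF measurable_shift E] by simp
  have "measure \<mu> (shift -` E \<inter> codes 2) = (\<Sum>p<d. measure (\<nu> (p + 1)) E) / d"
    using measure_\<mu>[OF E'] measure_\<nu>_shift_pow[OF E, of _ 1] by simp
  also have "\<dots> = (\<Sum>p<d. measure (\<nu> p) E) / d"
    by (subst sum_phase_shift[of "\<lambda>p. measure (\<nu> p) E" 1]) (simp_all add: \<nu>_add_d)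
  also have "\<dots> = measure \<mu> E" using measure_\<mu>[OF E] by simp
  finally show "measure \<mu> (shift -` E \<inter> space \<mu>) = measure \<mu> E" by simp
qed

text \<open>
  A shift-invariant event lies in the tail, so each \<open>\<nu> p\<close> makes it independent of all cylinders and
  hence of itself; and all \<open>\<nu> p\<close> give it the same mass, because they are shifts of each other.
\<close>

lemma ergodic_\<mu>: "ergodic_prob 2 \<mu>"
  unfolding ergodic_prob_def
proof (intro conjI ballI impI shift_invariant_\<mu>)
  fix E assume "E \<in> sets \<mu>" and inv': "shift -` E \<inter> space \<mu> = E"
  then have E [measurable]: "E \<in> sets code_space" by simp
  have inv: "(shift ^^ n) -` E \<inter> codes 2 = E" for n
  proof (induction n)
    case 0 then show ?case using sets.sets_into_space[OF E] by auto
  next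
    case (Suc n)
    have "(shift ^^ Suc n) -` E \<inter> codes 2 = shift -` ((shift ^^ n) -` E \<inter> codes 2) \<inter> codes 2"
      using codes_shift by (auto simp: funpow_Suc_right simp del: funpow.simps)
    moreover have "shift -` E \<inter> codes 2 = E" using inv' by simp
    ultimately show ?case by (simp only: Suc)
  qed
  define e where "e = emeasure (\<nu> 0) E"
  have e: "emeasure (\<nu> p) E = e" for p
    using emeasure_\<nu>_shift_pow[OF E, of 0 p] inv by (simp add: e_def)
  have e1: "e \<le> 1"
    unfolding e_def by (rule prob_space.measure_le_1[OF prob_space_\<nu>])
  have ind: "emeasure (\<nu> 0) (cyl w n \<inter> E) = e * emeasure (\<nu> 0) (cyl w n)" for w n
  proof -
    have dep: "depends_on n (indicator (cyl w n) :: _ \<Rightarrow> ennreal)"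
      unfolding depends_on_def by (intro ballI impI) (simp add: indicator_def cyl_def)
    have "emeasure (\<nu> 0) (cyl w n \<inter> E) = (\<integral>\<^sup>+v. indicator (cyl w n \<inter> E) v \<partial>\<nu> 0)" by simp
    also have "\<dots> = (\<integral>\<^sup>+v. indicator (cyl w n) v * indicator E ((shift ^^ n) v) \<partial>\<nu> 0)"
      using inv[of n] by (intro nn_integral_cong) (auto simp: indicator_def)
    also have "\<dots> = e * emeasure (\<nu> 0) (cyl w n)"
      by (subst nn_integral_\<nu>_split[OF dep]) (auto simp: e mult.commute)
    finally show ?thesis .
  qed
  have "density (\<nu> 0) (indicator E) = scale_measure e (\<nu> 0)"
  proof (rule code_measure_eqI)
    have "emeasure (density (\<nu> 0) (indicator E)) (codes 2) = e"
      using sets.sets_into_space[OF E] by (subst emeasure_density) (auto simp: indicator_inter_arith[symmetric] Int_absorb2 e sets.top[of code_space, simplified])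
    then show "finite_measure (density (\<nu> 0) (indicator E))"
      using e1 by (intro finite_measureI) (auto simp: top_unique)
    show "emeasure (density (\<nu> 0) (indicator E)) (cyl w n) = emeasure (scale_measure e (\<nu> 0)) (cyl w n)" for w n
      using ind by (subst emeasure_density) (auto simp: indicator_inter_arith[symmetric] Int_commute)
  qed auto
  then have "emeasure (density (\<nu> 0) (indicator E)) E = e * e" by (simp add: e)
  moreover have "emeasure (density (\<nu> 0) (indicator E)) E = e"
    by (subst emeasure_density) (auto simp: indicator_inter_arith[symmetric] e)
  ultimately have "e = e * e" by simp
  moreover obtain x where "e = ennreal x" "0 \<le> x" using e1 by (cases e) (auto simp: top_unique)
  ultimately have "e = 0 \<or> e = 1" by (auto simp: ennreal_mult[symmetric])
  moreover have "measure \<mu> E = (\<Sum>p<d. enn2real e) / d"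
    using measure_\<mu>[OF E] by (simp add: measure_def e)
  ultimately show "measure \<mu> E = 0 \<or> measure \<mu> E = 1" using d_pos by auto
qed

end

section \<open>Uniqueness of the invariant measure with vanishing exponential excess\<close>

text \<open>
  The form in which almost sure asymptotic statements are used below: convergence in measure of the
  exceptional sets.
\<close>

lemma (in finite_measure) measure_not_eventually_tendsto_0:
  assumes "AE x in M. eventually (\<lambda>n. P n x) sequentially"
    and meas: "\<And>n. {x\<in>space M. \<not> P n x} \<in> sets M"
  shows "(\<lambda>n. measure M {x\<in>space M. \<not> P n x}) \<longlonglongrightarrow> 0"
proof -
  have "(\<lambda>n. \<integral>x. indicator {x\<in>space M. \<not> P n x} x \<partial>M) \<longlonglongrightarrow> (\<integral>x. (0::real) \<partial>M)"
  proof (rule integral_dominated_convergence[where w="\<lambda>_. 1"])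
    show "AE x in M. (\<lambda>n. indicator {x\<in>space M. \<not> P n x} x) \<longlonglongrightarrow> (0::real)"
      using assms(1)
    proof eventually_elim
      case (elim x)
      show ?case
        by (rule tendsto_eventually) (use elim in \<open>eventually_elim, simp\<close>)
    qed
  qed (use meas in \<open>auto simp: indicator_def\<close>)
  then show ?thesis using meas by (simp add: Int_absorb1 sets.sets_into_space)
qed

lemma shift_invariant_distr_pow:
  assumes "shift_invariant_prob 2 M"
  shows "distr M code_space (shift ^^ n) = M"
proof -
  have sets: "sets M = sets code_space" and sp: "space M = codes 2" and pr: "prob_space M"
    using assms by (auto simp: shift_invariant_prob_def code_space_def)
  interpret prob_space M by (rule pr)
  have [measurable]: "(shift ^^ n) \<in> measurable M code_space" for n
    by (simp add: measurable_cong_sets[OF sets refl])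
  have [measurable]: "shift \<in> measurable M code_space"
    by (simp add: measurable_cong_sets[OF sets refl])
  have 1: "distr M code_space shift = M"
  proof (rule measure_eqI)
    fix E assume "E \<in> sets (distr M code_space shift)"
    then have "E \<in> sets M" by (simp add: sets)
    then show "emeasure (distr M code_space shift) E = emeasure M E"
      using assms by (subst emeasure_distr) (auto simp: shift_invariant_prob_def emeasure_eq_measure sets)
  qed (simp add: sets)
  show ?thesis
  proof (induction n)
    case 0
    show ?case by (simp add: distr_id2 sets)
  next
    case (Suc n)
    have "distr M code_space (shift ^^ Suc n) = distr (distr M code_space (shift ^^ n)) code_space shift"
      by (subst distr_distr) auto
    then show ?case by (simp only: Suc 1)
  qed
qed

context phases
begin

text \<open>
  The indicator of a cylinder has different means under the measures \<open>\<nu> p\<close>. Averaging it along a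
  period of the shift removes the dependence on \<open>p\<close> (\<open>integral_freq_\<nu>\<close> below), without
  changing the mean under an invariant measure.
\<close>

definition freq :: "(nat \<Rightarrow> nat) \<Rightarrow> nat \<Rightarrow> (nat \<Rightarrow> nat) \<Rightarrow> real" where
  "freq u m w = (\<Sum>i<d. indicator (cyl u m) ((shift ^^ i) w)) / d"

lemma freq_bounds: "0 \<le> freq u m w" "freq u m w \<le> 1"
proof -
  have "(\<Sum>i<d. indicator (cyl u m) ((shift ^^ i) w) :: real) \<le> (\<Sum>i<d. 1)"
    by (intro sum_mono) (auto simp: indicator_def)
  then show "freq u m w \<le> 1" using d_pos by (simp add: freq_def)
  show "0 \<le> freq u m w" by (simp add: freq_def sum_nonneg)
qed

text \<open>
  Only the first \<open>d - 1 + m\<close> digits enter \<open>freq\<close>; the block length \<open>d * (m + 1)\<close> is chosen as a multiple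
  of the period that is at least as large.
\<close>

lemma depends_on_freq: "depends_on (d * (m + 1)) (freq u m)"
proof -
  have "i + m \<le> d * (m + 1)" if "i < d" for i
  proof -
    have "m \<le> d * m" using d_pos by simp
    then show ?thesis using that by (simp add: add_mono)
  qed
  then have "depends_on (d * (m + 1)) (\<lambda>w. \<Sum>i<d. indicator (cyl u m) ((shift ^^ i) w) :: real)"
    by (intro depends_on_sum depends_on_mono[OF depends_on_shift_pow[OF depends_on_cyl]]) auto
  from depends_on_compose[OF this, of "\<lambda>x. x / d"] show ?thesis
    by (simp add: freq_def[abs_def])
qed

lemma integral_indicator_shift_pow:
  assumes "sets M = sets code_space" "E \<in> sets code_space"
  shows "(\<integral>w. indicator E ((shift ^^ i) w) \<partial>M) = measure M ((shift ^^ i) -` E \<inter> codes 2)"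
proof -
  have sp: "space M = codes 2" using sets_eq_imp_space_eq[OF assms(1)] by simp
  have "(\<integral>w. indicator E ((shift ^^ i) w) \<partial>M) = (\<integral>w. indicator ((shift ^^ i) -` E \<inter> codes 2) w \<partial>M)"
    by (intro Bochner_Integration.integral_cong) (auto simp: indicator_def sp)
  also have "\<dots> = measure M ((shift ^^ i) -` E \<inter> codes 2 \<inter> space M)"
    by (rule Bochner_Integration.integral_indicator)
  finally show ?thesis by (simp add: sp Int_assoc)
qed

lemma integrable_freq_part:
  assumes "sets M = sets code_space" "finite_measure M"
  shows "integrable M (\<lambda>w. indicator (cyl u m) ((shift ^^ i) w) :: real)"
proof -
  interpret finite_measure M by fact
  have [measurable]: "(shift ^^ i) \<in> measurable M code_space"
    by (simp add: measurable_cong_sets[OF assms(1) refl])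
  show ?thesis by (rule integrable_const_bound[of _ 1]) auto
qed

lemma integral_freq:
  assumes "sets M = sets code_space" "finite_measure M"
  shows "(\<integral>w. freq u m w \<partial>M) = (\<Sum>i<d. measure M ((shift ^^ i) -` cyl u m \<inter> codes 2)) / d"
  unfolding freq_def
  by (simp add: Bochner_Integration.integral_sum[OF integrable_freq_part[OF assms]]
      integral_indicator_shift_pow[OF assms(1) sets_cyl])

lemma integral_freq_\<nu>: "(\<integral>w. freq u m w \<partial>\<nu> p) = measure \<mu> (cyl u m)"
proof -
  have "(\<integral>w. freq u m w \<partial>\<nu> p) = (\<Sum>i<d. measure (\<nu> (i + p)) (cyl u m)) / d"
    using prob_space_\<nu>
    by (subst integral_freq) (auto simp: measure_\<nu>_shift_pow prob_space.finite_measure add.commute)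
  also have "\<dots> = (\<Sum>i<d. measure (\<nu> i) (cyl u m)) / d"
    by (subst sum_phase_shift[of "\<lambda>i. measure (\<nu> i) (cyl u m)" p]) (simp_all add: \<nu>_add_d)
  finally show ?thesis by (simp add: measure_\<mu>)
qed

text \<open>
  Let \<open>a\<close> be the difference of the masses that \<open>M\<close> and \<open>\<mu>\<close> give to a cylinder, and put
  \<open>\<phi> = 1 + t (freq - c)\<close> with \<open>c\<close> the \<open>\<mu>\<close>-mass. The product \<open>Z n\<close> of \<open>\<phi>\<close> along \<open>n\<close> consecutive blocks
  has mean one under every \<open>\<nu> p\<close> and hence under \<open>\<mu>\<close>. As \<open>M\<close> exceeds \<open>\<mu>\<close> only by subexponential
  factors on typical cylinders, Markov's inequality shows that \<open>Z n\<close> does not grow exponentially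
  in \<open>M\<close>-probability. By invariance \<open>ln (Z n) / n\<close> has the same \<open>M\<close>-mean \<open>e\<close> for all \<open>n\<close>, so \<open>e \<le> 0\<close>. But
  \<open>e \<ge> t a - 2 t\<^sup>2\<close> from the second-order expansion of the logarithm, and for \<open>t = a / 4\<close> the right hand
  side is \<open>a\<^sup>2 / 8\<close>; so \<open>a = 0\<close>.
\<close>

lemma unique_invariant:
  assumes inv: "shift_invariant_prob 2 M"
    and excess: "\<And>\<delta>. 0 < \<delta> \<Longrightarrow> AE w in M. eventually (\<lambda>n.
        measure M (cyl w n) \<le> exp (\<delta> * real n) * measure \<mu> (cyl w n)) sequentially"
  shows "M = \<mu>"
proof -
  have sets: "sets M = sets code_space" and sp: "space M = codes 2" and pr: "prob_space M"
    using inv by (auto simp: shift_invariant_prob_def code_space_def)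
  interpret M: prob_space M by (rule pr)
  interpret P: prob_space \<mu> by (rule prob_space_\<mu>)
  have M_meas: "g \<in> borel_measurable M" if "depends_on n g" for g :: "_ \<Rightarrow> real" and n
    using depends_on_measurable[OF that] by (simp add: measurable_cong_sets[OF sets refl])
  have shiftM: "(shift ^^ n) \<in> measurable M code_space" for n
    by (simp add: measurable_cong_sets[OF sets refl])
  have "measure M (cyl u m) = measure \<mu> (cyl u m)" for u m
  proof -
    define c where "c = measure \<mu> (cyl u m)"
    define a where "a = measure M (cyl u m) - c"
    define t where "t = a / 4"
    define L where "L = d * (m + 1)"
    define \<phi> where "\<phi> w = 1 + t * (freq u m w - c)" for w
    define Z where "Z n w = (\<Prod>k<n. \<phi> ((shift ^^ (k * L)) w))" for n w
    have a1: "\<bar>a\<bar> \<le> 1" unfolding a_def c_def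
      using M.prob_le_1 P.prob_le_1 measure_nonneg[of M "cyl u m"] measure_nonneg[of \<mu> "cyl u m"]
      by (smt (verit))
    have c01: "0 \<le> c" "c \<le> 1" unfolding c_def using P.prob_le_1 by auto
    have fc: "\<bar>freq u m w - c\<bar> \<le> 1" for w using freq_bounds[of u m w] c01 by linarith
    have tf: "\<bar>t * (freq u m w - c)\<bar> \<le> 1/4" for w
    proof -
      have "\<bar>t\<bar> * \<bar>freq u m w - c\<bar> \<le> (1/4) * 1" using a1 fc[of w] by (intro mult_mono) (auto simp: t_def)
      then show ?thesis by (simp add: abs_mult)
    qed
    have \<phi>_pos: "3/4 \<le> \<phi> w" "\<phi> w \<le> 5/4" for w using tf[of w] by (auto simp: \<phi>_def abs_le_iff)
    have \<phi>_dep: "depends_on L \<phi>"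
      using depends_on_compose[OF depends_on_freq[of m u], of "\<lambda>x. 1 + t * (x - c)"]
      by (simp add: \<phi>_def[abs_def] L_def)
    have \<phi>_gt0: "0 < \<phi> w" for w using \<phi>_pos(1)[of w] by linarith
    have Z_pos: "0 < Z n w" for n w unfolding Z_def using \<phi>_gt0 by (intro prod_pos) auto
    have Z_Suc: "Z (Suc n) w = \<phi> w * Z n ((shift ^^ L) w)" for n w
      unfolding Z_def by (subst prod.lessThan_Suc_shift) (simp add: funpow_add[symmetric, THEN fun_cong, unfolded comp_def] add.commute)
    have Z_dep: "depends_on (n * L) (Z n)" for n
      unfolding Z_def[abs_def]
    proof (rule depends_on_prod)
      fix k assume "k \<in> {..<n}"
      then have "Suc k * L \<le> n * L" by (intro mult_le_mono1) simp
      then show "depends_on (n * L) (\<lambda>w. \<phi> ((shift ^^ (k * L)) w))"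
        by (intro depends_on_mono[OF depends_on_shift_pow[OF \<phi>_dep]]) (simp add: add.commute)
    qed
    \<comment> \<open>Under every phase, \<open>\<phi>\<close> has mean one, so \<open>Z\<close> is a likelihood ratio with respect to \<open>\<mu>\<close>.\<close>
    have int_\<phi>: "(\<integral>\<^sup>+w. ennreal (\<phi> w) \<partial>\<nu> p) = 1" for p
    proof -
      interpret N: prob_space "\<nu> p" by (rule prob_space_\<nu>)
      have m: "freq u m \<in> borel_measurable (\<nu> p)"
        using depends_on_measurable[OF depends_on_freq[of m u]] by simp
      have i: "integrable (\<nu> p) (freq u m)"
        using m freq_bounds by (intro N.integrable_const_bound[of _ 1]) auto
      have "(\<integral>\<^sup>+w. ennreal (\<phi> w) \<partial>\<nu> p) = ennreal (\<integral>w. \<phi> w \<partial>\<nu> p)"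
      proof (rule nn_integral_eq_integral)
        show "integrable (\<nu> p) \<phi>" unfolding \<phi>_def[abs_def] using i by auto
      qed (use \<phi>_gt0 in \<open>auto intro: less_imp_le\<close>)
      also have "(\<integral>w. \<phi> w \<partial>\<nu> p) = 1 + t * ((\<integral>w. freq u m w \<partial>\<nu> p) - c)"
        unfolding \<phi>_def using i N.prob_space by (simp add: right_diff_distrib)
      also have "\<dots> = 1" by (simp add: integral_freq_\<nu> c_def)
      finally show ?thesis by simp
    qed
    have int_Z: "(\<integral>\<^sup>+w. ennreal (Z n w) \<partial>\<nu> p) = 1" for n p
    proof (induction n arbitrary: p)
      case 0
      then show ?case using prob_space.emeasure_space_1[OF prob_space_\<nu>[of p]] by (simp add: Z_def)
    next
      case (Suc n)
      have "(\<integral>\<^sup>+w. ennreal (Z (Suc n) w) \<partial>\<nu> p) = (\<integral>\<^sup>+w. ennreal (\<phi> w) * ennreal (Z n ((shift ^^ L) w)) \<partial>\<nu> p)"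
        unfolding Z_Suc using \<phi>_gt0 Z_pos
        by (intro nn_integral_cong ennreal_mult) (auto intro: less_imp_le)
      also have "\<dots> = (\<integral>\<^sup>+w. ennreal (\<phi> w) \<partial>\<nu> p) * (\<integral>\<^sup>+w. ennreal (Z n w) \<partial>\<nu> (p + L))"
        using depends_on_measurable[OF Z_dep]
        by (intro nn_integral_\<nu>_split depends_on_compose[OF \<phi>_dep]) auto
      finally show ?case using Suc int_\<phi> by simp
    qed
    have int_Z_\<mu>: "(\<Sum>v\<in>words (n * L). Z n v * measure \<mu> (cyl v (n * L))) = 1" for n
    proof -
      have "(\<integral>\<^sup>+w. ennreal (Z n w) \<partial>\<mu>) = 1"
        using depends_on_measurable[OF Z_dep] d_pos
        by (subst nn_integral_\<mu>) (auto simp: int_Z ennreal_of_nat_eq_real_of_nat divide_ennreal)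
      moreover have "(\<integral>\<^sup>+w. ennreal (Z n w) \<partial>\<mu>) = ennreal (\<Sum>v\<in>words (n * L). Z n v * measure \<mu> (cyl v (n * L)))"
        by (subst nn_integral_words[OF sets_\<mu> depends_on_compose[OF Z_dep]])
          (simp add: P.emeasure_eq_measure ennreal_mult[symmetric] less_imp_le[OF Z_pos] sum_ennreal)
      ultimately show ?thesis by (simp add: sum_nonneg less_imp_le[OF Z_pos])
    qed
    \<comment> \<open>By invariance the exponential growth rate of \<open>Z\<close> has the same mean \<open>e\<close> for all \<open>n\<close>.\<close>
    define e where "e = (\<integral>w. ln (\<phi> w) \<partial>M)"
    have ln_\<phi>: "\<bar>ln (\<phi> w)\<bar> \<le> 1" "ln (\<phi> w) \<ge> t * (freq u m w - c) - 2 * t\<^sup>2" for w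
    proof -
      define y where "y = t * (freq u m w - c)"
      have y: "\<bar>y\<bar> \<le> 1/4" using tf by (simp add: y_def)
      have b: "\<bar>ln (1 + y) - y\<bar> \<le> 2 * y\<^sup>2" using y by (intro abs_ln_one_plus_x_minus_x_bound) auto
      have "y\<^sup>2 \<le> (1/4)\<^sup>2" using power_mono[OF y, of 2] by simp
      moreover have "(freq u m w - c)\<^sup>2 \<le> 1" using power_mono[OF fc[of w], of 2] by simp
      then have "y\<^sup>2 \<le> t\<^sup>2" unfolding y_def power_mult_distrib by (simp add: mult_left_le)
      ultimately show "\<bar>ln (\<phi> w)\<bar> \<le> 1" "ln (\<phi> w) \<ge> t * (freq u m w - c) - 2 * t\<^sup>2"
        using b y unfolding \<phi>_def y_def[symmetric] by (auto simp: power2_eq_square)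
    qed
    have i_ln: "integrable M (\<lambda>w. ln (\<phi> ((shift ^^ k) w)))" for k
    proof (rule M.integrable_const_bound[of _ 1])
      show "(\<lambda>w. ln (\<phi> ((shift ^^ k) w))) \<in> borel_measurable M"
        by (rule M_meas[OF depends_on_compose[OF depends_on_shift_pow[OF \<phi>_dep]]])
    qed (use ln_\<phi>(1) in auto)
    have int_ln: "(\<integral>w. ln (\<phi> ((shift ^^ k) w)) \<partial>M) = e" for k
    proof -
      have "(\<integral>w. ln (\<phi> w) \<partial>distr M code_space (shift ^^ k)) = (\<integral>w. ln (\<phi> ((shift ^^ k) w)) \<partial>M)"
        by (rule integral_distr[OF shiftM depends_on_measurable[OF depends_on_compose[OF \<phi>_dep]]])
      then show ?thesis using shift_invariant_distr_pow[OF inv] by (simp add: e_def)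
    qed
    have "e \<le> \<epsilon>" if \<epsilon>: "0 < \<epsilon>" for \<epsilon>
    proof -
      define \<delta> where "\<delta> = \<epsilon> / (2 * L)"
      have L_pos: "0 < L" using d_pos by (simp add: L_def)
      have \<delta>: "0 < \<delta>" using \<epsilon> L_pos by (simp add: \<delta>_def)
      define G where "G n w \<longleftrightarrow> measure M (cyl w n) \<le> exp (\<delta> * real n) * measure \<mu> (cyl w n)" for n w
      have G_dep: "depends_on n (G n)" for n
        using depends_on_cyl_center[of n "\<lambda>E. measure M E \<le> exp (\<delta> * real n) * measure \<mu> E"]
        by (simp add: G_def[abs_def])
      have bad0: "(\<lambda>n. measure M {w\<in>space M. \<not> G n w}) \<longlonglongrightarrow> 0"
        using excess[OF \<delta>] depends_on_sets[OF depends_on_compose[OF G_dep, where h=Not]]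
        by (intro M.measure_not_eventually_tendsto_0) (auto simp: G_def sp sets)
      have "filterlim (\<lambda>n. n * L) at_top sequentially"
        using L_pos by (intro filterlim_subseq strict_monoI) simp
      from filterlim_compose[OF bad0 this]
      have bad: "(\<lambda>n. measure M {w\<in>codes 2. \<not> G (n * L) w}) \<longlonglongrightarrow> 0" by (simp add: sp)
      \<comment> \<open>On \<open>B n\<close> the product \<open>Z n\<close> is large although \<open>M\<close> is dominated on the cylinder; the half of
        the exponent that is not spent on the domination makes \<open>B n\<close> small.\<close>
      define B where "B n w \<longleftrightarrow> exp (\<epsilon> * n) < Z n w \<and> G (n * L) w" for n w
      have B_dep: "depends_on (n * L) (B n)" for n
        unfolding B_def[abs_def]
        by (rule depends_on_compose2[OF Z_dep G_dep, where h="\<lambda>z g. exp (\<epsilon> * n) < z \<and> g"])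
      have B_small: "measure M {w\<in>codes 2. B n w} \<le> exp (- (\<epsilon>/2) * n)" for n
      proof -
        have "emeasure M {w\<in>codes 2. B n w} = (\<Sum>v\<in>{v\<in>words (n * L). B n v}. emeasure M (cyl v (n * L)))"
          by (rule emeasure_words[OF sets B_dep])
        then have "measure M {w\<in>codes 2. B n w} = (\<Sum>v\<in>{v\<in>words (n * L). B n v}. measure M (cyl v (n * L)))"
          by (simp add: M.emeasure_eq_measure sum_ennreal sum_nonneg)
        also have "\<dots> \<le> (\<Sum>v\<in>{v\<in>words (n * L). B n v}. exp (- (\<epsilon>/2) * n) * (Z n v * measure \<mu> (cyl v (n * L))))"
        proof (rule sum_mono)
          fix v assume "v \<in> {v\<in>words (n * L). B n v}"
          then have v: "exp (\<epsilon> * n) < Z n v" "G (n * L) v" by (auto simp: B_def)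
          have exponent: "\<delta> * real (n * L) = (\<epsilon>/2) * n" using L_pos by (simp add: \<delta>_def)
          have "measure M (cyl v (n * L)) \<le> exp ((\<epsilon>/2) * n) * measure \<mu> (cyl v (n * L))"
            using v(2) unfolding G_def exponent .
          also have "exp ((\<epsilon>/2) * n) = exp (- (\<epsilon>/2) * n) * exp (\<epsilon> * n)"
            by (simp add: exp_add[symmetric] field_simps)
          also have "\<dots> * measure \<mu> (cyl v (n * L)) \<le> (exp (- (\<epsilon>/2) * n) * Z n v) * measure \<mu> (cyl v (n * L))"
            using v(1) by (intro mult_right_mono mult_left_mono) auto
          finally show "measure M (cyl v (n * L)) \<le> exp (- (\<epsilon>/2) * n) * (Z n v * measure \<mu> (cyl v (n * L)))"
            by (simp add: mult.assoc)
        qed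
        also have "\<dots> \<le> (\<Sum>v\<in>words (n * L). exp (- (\<epsilon>/2) * n) * (Z n v * measure \<mu> (cyl v (n * L))))"
          using finite_words less_imp_le[OF Z_pos] by (intro sum_mono2) auto
        also have "\<dots> = exp (- (\<epsilon>/2) * n)"
          using int_Z_\<mu>[of n] by (simp add: sum_distrib_left[symmetric])
        finally show ?thesis .
      qed
      have main: "e \<le> \<epsilon> + exp (- (\<epsilon>/2) * n) + measure M {w\<in>codes 2. \<not> G (n * L) w}" if n: "0 < n" for n
      proof -
        have lnZ: "ln (Z n w) = (\<Sum>k<n. ln (\<phi> ((shift ^^ (k * L)) w)))" for w
          unfolding Z_def by (rule ln_prod) (use \<phi>_gt0 order_less_irrefl in \<open>metis finite_lessThan\<close>)+
        have SB: "{w\<in>codes 2. B n w} \<in> sets M" "{w\<in>codes 2. \<not> G (n * L) w} \<in> sets M"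
          using depends_on_sets[OF B_dep] depends_on_sets[OF depends_on_compose[OF G_dep, where h=Not]] sets by auto
        have iB: "integrable M (\<lambda>w. indicator {w\<in>codes 2. B n w} w :: real)"
          and iG: "integrable M (\<lambda>w. indicator {w\<in>codes 2. \<not> G (n * L) w} w :: real)"
          by (auto intro!: integrable_real_indicator SB simp: M.emeasure_eq_measure)
        have trace: "{w\<in>codes 2. B n w} \<inter> codes 2 = {w\<in>codes 2. B n w}"
            "{w\<in>codes 2. \<not> G (n * L) w} \<inter> codes 2 = {w\<in>codes 2. \<not> G (n * L) w}" by auto
        have "n * e = (\<integral>w. ln (Z n w) \<partial>M)"
          unfolding lnZ by (subst Bochner_Integration.integral_sum) (auto simp: i_ln int_ln)
        also have "\<dots> \<le> (\<integral>w. n * (\<epsilon> + indicator {w\<in>codes 2. B n w} w + indicator {w\<in>codes 2. \<not> G (n * L) w} w) \<partial>M)"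
        proof (rule integral_mono)
          show "integrable M (\<lambda>w. ln (Z n w))" unfolding lnZ using i_ln by auto
          show "integrable M (\<lambda>w. n * (\<epsilon> + indicator {w\<in>codes 2. B n w} w + indicator {w\<in>codes 2. \<not> G (n * L) w} w))"
            using iB iG by (intro integrable_mult_right Bochner_Integration.integrable_add M.integrable_const)
          fix w assume w: "w \<in> space M"
          have "ln (Z n w) \<le> (\<Sum>k<n. 1)"
            unfolding lnZ using ln_\<phi>(1) by (intro sum_mono) (simp add: abs_le_iff)
          then have "ln (Z n w) \<le> n" by simp
          moreover have "ln (Z n w) \<le> \<epsilon> * n" if "Z n w \<le> exp (\<epsilon> * n)"
            using that Z_pos[of n w] by (metis ln_exp ln_mono)
          ultimately show "ln (Z n w) \<le> n * (\<epsilon> + indicator {w\<in>codes 2. B n w} w + indicator {w\<in>codes 2. \<not> G (n * L) w} w)"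
            using w \<epsilon> sp
            by (cases "G (n * L) w"; cases "Z n w \<le> exp (\<epsilon> * n)")
              (simp_all add: indicator_def B_def distrib_left mult.commute add_increasing add_increasing2)
        qed
        also have "\<dots> = n * (\<epsilon> + measure M {w\<in>codes 2. B n w} + measure M {w\<in>codes 2. \<not> G (n * L) w})"
          using iB iG M.prob_space by (simp add: sp trace)
        finally have "e \<le> \<epsilon> + measure M {w\<in>codes 2. B n w} + measure M {w\<in>codes 2. \<not> G (n * L) w}"
          using n by simp
        then show ?thesis using B_small[of n] by simp
      qed
      have "(\<lambda>n. exp (- (\<epsilon>/2) * n)) \<longlonglongrightarrow> 0"
      proof -
        have "(\<lambda>n. exp (- (\<epsilon>/2)) ^ n) \<longlonglongrightarrow> 0" using \<epsilon> by (intro LIMSEQ_realpow_zero) auto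
        then show ?thesis by (simp add: exp_of_nat_mult[symmetric] mult.commute)
      qed
      from tendsto_add[OF tendsto_add[OF tendsto_const[of \<epsilon>] this] bad]
      have "(\<lambda>n. \<epsilon> + exp (- (\<epsilon>/2) * n) + measure M {w\<in>codes 2. \<not> G (n * L) w}) \<longlonglongrightarrow> \<epsilon>" by simp
      then show "e \<le> \<epsilon>"
        by (rule tendsto_lowerbound) (use main in \<open>auto intro!: eventually_sequentiallyI[of 1]\<close>)
    qed
    then have "e \<le> 0" by (metis add_0 field_le_epsilon)
    moreover have "t * a - 2 * t\<^sup>2 \<le> e"
    proof -
      have i: "integrable M (freq u m)"
        using M_meas[OF depends_on_freq] freq_bounds by (intro M.integrable_const_bound[of _ 1]) auto
      have *: "measure M ((shift ^^ i) -` cyl u m \<inter> codes 2) = measure M (cyl u m)" for i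
        using measure_distr[OF shiftM, of "cyl u m" i] sets_cyl[of u m] shift_invariant_distr_pow[OF inv, of i]
        by (simp add: sp)
      have "(\<integral>w. freq u m w \<partial>M) = measure M (cyl u m)"
        using d_pos by (subst integral_freq) (auto simp: sets * M.finite_measure_axioms)
      then have "t * a - 2 * t\<^sup>2 = (\<integral>w. t * (freq u m w - c) - 2 * t\<^sup>2 \<partial>M)"
        using i M.prob_space by (simp add: a_def)
      also have "\<dots> \<le> e"
        unfolding e_def using i i_ln[of 0] ln_\<phi>(2) by (intro integral_mono) auto
      finally show ?thesis .
    qed
    ultimately have "t * a - 2 * t\<^sup>2 \<le> 0" by linarith
    then have "a\<^sup>2 \<le> 0" by (simp add: t_def power2_eq_square)
    then show ?thesis by (simp add: a_def c_def)
  qed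
  then show ?thesis
    by (intro code_measure_eqI)
      (auto simp: sets M.emeasure_eq_measure P.emeasure_eq_measure M.finite_measure_axioms)
qed

end

section \<open>Coordinates of the coded points\<close>

context phases
begin

text \<open>
  The piece of digit 0 is glued to the left end of the unit interval, the piece of digit 1 to its right
  end.
\<close>

definition offset :: "nat \<Rightarrow> nat \<Rightarrow> real" where
  "offset p i = (if i = 0 then 0 else 1 - (wt p 1)\<^sup>2)"

definition coord :: "nat \<Rightarrow> (nat \<Rightarrow> nat) \<Rightarrow> real" where
  "coord p w = (\<Sum>k. (q p w k)\<^sup>2 * offset (p + k) (w k))"

lemma offset_bounds: "0 \<le> offset p i" "offset p i \<le> 1"
  by (auto simp: offset_def wt_def power2_eq_square)

lemma offset_mod: "offset (p mod d) i = offset p i"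
  by (simp add: offset_def wt_mod)

lemma q2_le: "(q p w n)\<^sup>2 \<le> (16/25) ^ n"
proof -
  have "(q p w n)\<^sup>2 \<le> ((4/5) ^ n)\<^sup>2" by (intro power_mono q_le q_nonneg)
  also have "\<dots> = (16/25) ^ n" by (simp add: power2_eq_square power_mult_distrib[symmetric])
  finally show ?thesis .
qed

lemma summable_coord: "summable (\<lambda>k. (q p w k)\<^sup>2 * offset (p + k) (w k))"
proof (rule summable_comparison_test')
  show "summable (\<lambda>k. (16/25::real) ^ k)" by (rule summable_geometric) simp
  show "norm ((q p w k)\<^sup>2 * offset (p + k) (w k)) \<le> (16/25) ^ k" for k
    using mult_mono[OF q2_le[of p w k] offset_bounds(2) _ offset_bounds(1)] offset_bounds(1)[of "p + k" "w k"]
    by simp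
qed

lemma q_add: "q p w (n + k) = q p w n * q (p + n) ((shift ^^ n) w) k"
  by (induction k) (simp_all add: q_Suc shift_pow add.assoc)

lemma coord_split:
  "coord p w = (\<Sum>k<n. (q p w k)\<^sup>2 * offset (p + k) (w k)) + (q p w n)\<^sup>2 * coord (p + n) ((shift ^^ n) w)"
proof -
  have "coord p w = (\<Sum>k. (q p w (k + n))\<^sup>2 * offset (p + (k + n)) (w (k + n)))
      + (\<Sum>k<n. (q p w k)\<^sup>2 * offset (p + k) (w k))"
    unfolding coord_def by (rule suminf_split_initial_segment[OF summable_coord])
  also have "(\<lambda>k. (q p w (k + n))\<^sup>2 * offset (p + (k + n)) (w (k + n)))
      = (\<lambda>k. (q p w n)\<^sup>2 * ((q (p + n) ((shift ^^ n) w) k)\<^sup>2 * offset (p + n + k) ((shift ^^ n) w k)))"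
    using q_add[of p w n] by (intro ext) (simp add: ac_simps shift_pow power_mult_distrib)
  also have "suminf \<dots> = (q p w n)\<^sup>2 * coord (p + n) ((shift ^^ n) w)"
    unfolding coord_def by (rule suminf_mult[OF summable_coord])
  finally show ?thesis by simp
qed

lemma coord_unroll: "coord p w = (wt p (w 0))\<^sup>2 * coord (Suc p) (shift w) + offset p (w 0)"
  using coord_split[of p w 1] by (simp add: q_Suc)

lemma coord_mod: "coord (p mod d) w = coord p w"
proof -
  have "offset (p mod d + k) i = offset (p + k) i" for k i
    by (metis mod_add_left_eq offset_mod)
  then show ?thesis by (simp add: coord_def q_mod)
qed

lemma coord_nonneg: "0 \<le> coord p w"
  unfolding coord_def by (intro suminf_nonneg summable_coord) (simp add: offset_bounds)

text \<open>The map of digit \<open>i\<close> sends the unit interval into itself: \<open>offset + wt\<^sup>2 \<le> 1\<close>.\<close>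

lemma coord_le_1:
  assumes "w \<in> codes 2" shows "coord p w \<le> 1"
  unfolding coord_def
proof (rule suminf_le_const[OF summable_coord])
  fix n
  have "(\<Sum>k<n. (q p w k)\<^sup>2 * offset (p + k) (w k)) + (q p w n)\<^sup>2 \<le> 1"
  proof (induction n)
    case (Suc n)
    have "w n < 2" using assms by (simp add: codes_def)
    then have "offset (p + n) (w n) + (wt (p + n) (w n))\<^sup>2 \<le> 1"
      by (cases "w n = 0") (auto simp: offset_def wt_def power2_eq_square)
    then have "(q p w n)\<^sup>2 * (offset (p + n) (w n) + (wt (p + n) (w n))\<^sup>2) \<le> (q p w n)\<^sup>2"
      by (intro mult_left_le) auto
    then show ?case using Suc by (simp add: q_Suc power_mult_distrib distrib_left)
  qed simp
  then show "(\<Sum>k<n. (q p w k)\<^sup>2 * offset (p + k) (w k)) \<le> 1"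
    using zero_le_power2[of "q p w n"] by linarith
qed

lemma coord_near:
  assumes w: "w \<in> codes 2" and w': "w' \<in> cyl w n"
  shows "\<bar>coord p w' - coord p w\<bar> \<le> (q p w n)\<^sup>2"
proof -
  have eq: "w' k = w k" if "k < n" for k using w' that by (simp add: cyl_def)
  have "(\<Sum>k<n. (q p w' k)\<^sup>2 * offset (p + k) (w' k)) = (\<Sum>k<n. (q p w k)\<^sup>2 * offset (p + k) (w k))"
    using eq by (intro sum.cong refl arg_cong2[where f="(*)"] arg_cong[where f="\<lambda>x. x\<^sup>2"] q_cong) auto
  moreover have "q p w' n = q p w n" using w' by (rule q_cyl)
  ultimately have "coord p w' - coord p w = (q p w n)\<^sup>2 * (coord (p + n) ((shift ^^ n) w') - coord (p + n) ((shift ^^ n) w))"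
    using coord_split[of p w n] coord_split[of p w' n] by (simp add: right_diff_distrib)
  moreover have "\<bar>coord (p + n) ((shift ^^ n) w') - coord (p + n) ((shift ^^ n) w)\<bar> \<le> 1"
    using coord_nonneg[of "p + n"] coord_le_1[OF codes_shift_pow[of _ 2], of _ "p + n" n] w w' cyl_sub
    by (smt (verit, best) subsetD)
  ultimately show ?thesis by (simp add: abs_mult mult_left_le)
qed

text \<open>
  The images of the unit interval under the maps of the digits 0 and 1 are \<open>[0, a\<^sup>2]\<close> and
  \<open>[1 - b\<^sup>2, 1]\<close> with \<open>a + b = 1\<close>; they are \<open>2 a b \<ge> 8/25\<close> apart.
\<close>

lemma coord_first_digit:
  assumes "w \<in> codes 2" "w' \<in> codes 2" "w 0 \<noteq> w' 0"
  shows "8/25 \<le> \<bar>coord p w - coord p w'\<bar>"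
proof -
  have gap: "8/25 \<le> coord p v' - coord p v" if v: "v \<in> codes 2" "v' \<in> codes 2" "v 0 = 0" "v' 0 = 1" for v v'
  proof -
    have "coord p v \<le> (wt p 0)\<^sup>2 * 1"
      unfolding coord_unroll[of p v] v(3) offset_def
      using mult_left_mono[OF coord_le_1[OF codes_shift[OF v(1)], of "Suc p"], of "(wt p 0)\<^sup>2"] by simp
    moreover have "coord p v' \<ge> 1 - (wt p 1)\<^sup>2"
      unfolding coord_unroll[of p v'] v(4) offset_def using coord_nonneg[of "Suc p" "shift v'"] by simp
    moreover have "(wt p 0)\<^sup>2 + (wt p 1)\<^sup>2 \<le> 17/25"
      by (auto simp: wt_def power2_eq_square)
    ultimately show ?thesis by linarith
  qed
  have "w 0 < 2" "w' 0 < 2" using assms by (auto simp: codes_def)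
  then consider "w 0 = 0" "w' 0 = 1" | "w 0 = 1" "w' 0 = 0" using assms(3) by linarith
  then show ?thesis using gap[of w w'] gap[of w' w] assms(1,2) by cases auto
qed

lemma q_antimono: "k \<le> n \<Longrightarrow> q p w n \<le> q p w k"
proof (induction rule: dec_induct)
  case (step m)
  have "q p w m * wt (p + m) (w m) \<le> q p w m * 1"
    using wt_le[of "p + m" "w m"] by (intro mult_left_mono q_nonneg) auto
  then show ?case using step by (simp add: q_Suc)
qed simp

text \<open>
  The separation is used at the first digit where the codes differ; up to there the expansions agree.
\<close>

lemma coord_far:
  assumes w: "w \<in> codes 2" and w': "w' \<in> codes 2" and "\<bar>coord p w' - coord p w\<bar> < 8/25 * (q p w n)\<^sup>2"
  shows "w' \<in> cyl w n"
proof (rule ccontr)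
  assume "w' \<notin> cyl w n"
  then have "\<exists>k. k < n \<and> w' k \<noteq> w k" using w' by (auto simp: cyl_def)
  then obtain k where k: "k < n" "w' k \<noteq> w k" and least: "\<And>j. j < k \<Longrightarrow> \<not> (j < n \<and> w' j \<noteq> w j)"
    using exists_least_iff[of "\<lambda>k. k < n \<and> w' k \<noteq> w k"] by blast
  have eq: "w' j = w j" if "j < k" for j using least[OF that] that k(1) by auto
  have "(\<Sum>j<k. (q p w' j)\<^sup>2 * offset (p + j) (w' j)) = (\<Sum>j<k. (q p w j)\<^sup>2 * offset (p + j) (w j))"
    using eq by (intro sum.cong refl arg_cong2[where f="(*)"] arg_cong[where f="\<lambda>x. x\<^sup>2"] q_cong) auto
  moreover have "q p w' k = q p w k" using eq by (rule q_cong)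
  ultimately have "coord p w' - coord p w = (q p w k)\<^sup>2 * (coord (p + k) ((shift ^^ k) w') - coord (p + k) ((shift ^^ k) w))"
    using coord_split[of p w k] coord_split[of p w' k] by (simp add: right_diff_distrib)
  moreover have "(q p w k)\<^sup>2 * (8/25)
      \<le> (q p w k)\<^sup>2 * \<bar>coord (p + k) ((shift ^^ k) w') - coord (p + k) ((shift ^^ k) w)\<bar>"
    using w w' k(2) by (intro mult_left_mono coord_first_digit codes_shift_pow) (auto simp: shift_pow)
  ultimately have "8/25 * (q p w k)\<^sup>2 \<le> \<bar>coord p w' - coord p w\<bar>"
    by (simp add: abs_mult)
  moreover have "(q p w n)\<^sup>2 \<le> (q p w k)\<^sup>2"
    using q_antimono[of k n p w] k(1) by (intro power_mono q_nonneg) auto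
  ultimately show False using assms(3) by linarith
qed

lemma open_agree: "open {w' :: nat \<Rightarrow> nat. \<forall>k<n. w' k = w k}"
proof -
  have "open ((\<lambda>w'. w' k) -` {w k} :: (nat \<Rightarrow> nat) set)" for k
    by (rule open_vimage) (simp_all add: discrete_topology_class.open_discrete)
  then have "open (\<Inter>k\<in>{..<n}. (\<lambda>w'. w' k) -` {w k} :: (nat \<Rightarrow> nat) set)"
    by (intro open_INT) auto
  moreover have "(\<Inter>k\<in>{..<n}. (\<lambda>w'. w' k) -` {w k}) = {w' :: nat \<Rightarrow> nat. \<forall>k<n. w' k = w k}" by auto
  ultimately show ?thesis by simp
qed

lemma continuous_on_coord: "continuous_on (codes 2) (coord p)"
  unfolding continuous_on_def
proof
  fix w assume w: "w \<in> codes 2"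
  show "(coord p \<longlongrightarrow> coord p w) (at w within codes 2)"
  proof (rule tendstoI)
    fix \<epsilon> :: real assume "0 < \<epsilon>"
    then obtain n where n: "(16/25 :: real) ^ n < \<epsilon>" using real_arch_pow_inv[of \<epsilon> "16/25"] by auto
    have "eventually (\<lambda>w'. w' \<in> {w'. \<forall>k<n. w' k = w k}) (nhds w)"
      by (rule eventually_nhds_in_open[OF open_agree]) simp
    then have "eventually (\<lambda>w'. w' \<in> codes 2 \<longrightarrow> dist (coord p w') (coord p w) < \<epsilon>) (nhds w)"
    proof eventually_elim
      case (elim w')
      show ?case
      proof
        assume "w' \<in> codes 2"
        then have "w' \<in> cyl w n" using elim by (simp add: cyl_def)
        from coord_near[OF w this, of p] q2_le[of p w n] n show "dist (coord p w') (coord p w) < \<epsilon>"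
          by (simp add: dist_real_def)
      qed
    qed
    then show "eventually (\<lambda>w'. dist (coord p w') (coord p w) < \<epsilon>) (at w within codes 2)"
      unfolding eventually_at_filter by (rule eventually_mono) auto
  qed
qed

end

section \<open>The affine iterated function system\<close>

lemma compact_codes: "compact (codes m)"
proof -
  have "compactin (product_topology (\<lambda>_::nat. euclidean) UNIV) (\<Pi>\<^sub>E k\<in>UNIV. {..<m})"
    by (subst compactin_PiE) (auto intro: finite_imp_compact)
  moreover have "(\<Pi>\<^sub>E k\<in>UNIV. {..<m}) = codes m" by (auto simp: codes_def PiE_iff)
  ultimately show ?thesis by (simp add: euclidean_product_topology)
qed

text \<open>
  The coordinates are numbered by phases through \<open>idx\<close>, with inverse \<open>e\<close>; the special coordinate is
  \<open>e 0\<close>.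
\<close>

locale cyclic_ifs = phases d for d :: nat +
  fixes e :: "nat \<Rightarrow> 'n::finite" and idx :: "'n \<Rightarrow> nat"
  assumes d_card: "d = CARD('n)"
    and idx_less: "idx t < d"
    and e_idx [simp]: "e (idx t) = t"
    and idx_e: "k < d \<Longrightarrow> idx (e k) = k"
begin

definition nxt :: "'n \<Rightarrow> 'n" where "nxt s = e (Suc (idx s) mod d)"

definition A :: "nat \<Rightarrow> real^'n^'n" where
  "A i = (\<chi> s t. if t = nxt s then (wt (idx s) i)\<^sup>2 else 0)"

definition u :: "nat \<Rightarrow> real^'n" where
  "u i = (\<chi> s. offset (idx s) i)"

lemma idx_e_mod [simp]: "idx (e (k mod d)) = k mod d"
  by (simp add: idx_e d_pos)

lemma idx_nxt: "idx (nxt s) = Suc (idx s) mod d"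
  by (simp add: nxt_def)

lemma A_mult: "(A i *v x) $ s = (wt (idx s) i)\<^sup>2 * x $ nxt s"
  by (simp add: A_def matrix_vector_mult_def if_distrib[where f="\<lambda>c. c * _"] cong: if_cong)

lemma affine_map_nth: "affine_map A u i x $ s = (wt (idx s) i)\<^sup>2 * x $ nxt s + offset (idx s) i"
  by (simp add: affine_map_def A_mult) (simp add: u_def)

lemma bij_idx: "bij_betw idx UNIV {..<d}"
  by (rule bij_betwI[of _ _ _ e]) (auto simp: idx_less idx_e)

lemma sum_idx: "(\<Sum>s\<in>UNIV. f (idx s)) = (\<Sum>p<d. f p)"
  by (rule sum.reindex_bij_betw[OF bij_idx])

lemma surj_nxt: "\<exists>s. nxt s = t"
proof
  have "Suc ((idx t + d - 1) mod d) mod d = (idx t + d) mod d"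
    using d_pos by (simp add: mod_Suc_eq)
  then have "Suc ((idx t + d - 1) mod d) mod d = idx t" using idx_less[of t] by simp
  then show "nxt (e ((idx t + d - 1) mod d)) = t" by (simp add: nxt_def)
qed

lemma invertible_A:
  assumes "i < 2" shows "invertible (A i)"
  unfolding invertible_left_inverse matrix_left_invertible_ker
proof (intro allI impI)
  fix x :: "real^'n" assume "A i *v x = 0"
  then have "(wt (idx s) i)\<^sup>2 * x $ nxt s = 0" for s by (metis A_mult zero_index)
  then have "x $ nxt s = 0" for s using wt_pos[OF assms, of "idx s"] by (metis less_irrefl mult_eq_0_iff power_eq_0_iff)
  then show "x = 0" using surj_nxt by (metis vec_eq_iff zero_index)
qed

text \<open>
  The maximum norm suits generalized permutation matrices: their norm is the largest entry.
\<close>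

lemma affine_ifs: "affine_ifs 2 A u"
  unfolding affine_ifs_def
proof (intro conjI allI impI exI[of _ infnorm])
  show "is_norm (infnorm :: real^'n \<Rightarrow> real)"
    unfolding is_norm_def by (auto simp: infnorm_pos_le infnorm_eq_0 infnorm_mul infnorm_triangle)
  fix i :: nat assume i: "i < 2"
  show "invertible (A i)" by (rule invertible_A[OF i])
  have "infnorm (affine_map A u i x - affine_map A u i y) \<le> 16/25 * infnorm (x - y)" for x y
    unfolding infnorm_cart[of "affine_map A u i x - affine_map A u i y"]
  proof (rule cSup_least)
    fix z assume "z \<in> {\<bar>(affine_map A u i x - affine_map A u i y) $ s\<bar> |s. s \<in> UNIV}"
    then obtain s where z: "z = \<bar>(affine_map A u i x - affine_map A u i y) $ s\<bar>" by auto
    have "z = (wt (idx s) i)\<^sup>2 * \<bar>(x - y) $ nxt s\<bar>"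
      unfolding z by (simp add: affine_map_nth abs_mult right_diff_distrib[symmetric])
    also have "\<dots> \<le> (4/5)\<^sup>2 * infnorm (x - y)"
      by (intro mult_mono power_mono wt_le wt_nonneg component_le_infnorm_cart) auto
    finally show "z \<le> 16/25 * infnorm (x - y)" by (simp add: power2_eq_square)
  qed auto
  then show "\<exists>c<1. \<forall>x y. infnorm (affine_map A u i x - affine_map A u i y) \<le> c * infnorm (x - y)"
    by (intro exI[of _ "16/25"]) auto
qed simp

text \<open>
  \<open>A 1 - A 0\<close> has rank one with range the special coordinate axis, and the cyclic shift of the
  coordinates moves any nonzero entry to the coordinate that \<open>A 1 - A 0\<close> reads, and this axis onto all
  the others.
\<close>

lemma irreducible: "irreducible_ifs 2 A"
  unfolding irreducible_ifs_def
proof (intro allI impI)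
  fix V :: "(real^'n) set"
  assume "subspace V \<and> (\<forall>i<2. (\<lambda>x. A i *v x) ` V \<subseteq> V)"
  then have V: "subspace V" and inv: "\<And>i x. i < 2 \<Longrightarrow> x \<in> V \<Longrightarrow> A i *v x \<in> V" by auto
  show "V = {0} \<or> V = UNIV"
  proof (rule disjCI)
    assume "V \<noteq> UNIV"
    show "V = {0}"
    proof (rule ccontr)
      assume "V \<noteq> {0}"
      then obtain x where x: "x \<in> V" "x \<noteq> 0" using subspace_0[OF V] by auto
      then obtain t where t: "x $ t \<noteq> 0" by (auto simp: vec_eq_iff)
      have ax: "axis (e 0) 1 \<in> V" if "x \<in> V" "x $ e (Suc k mod d) \<noteq> 0" for k x
        using that
      proof (induction k arbitrary: x)
        case 0
        have "A 1 *v x - A 0 *v x = (3/5 * x $ e (1 mod d)) *\<^sub>R axis (e 0) 1"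
        proof (rule vec_eq_iff[THEN iffD2, rule_format])
          fix s
          show "(A 1 *v x - A 0 *v x) $ s = ((3/5 * x $ e (1 mod d)) *\<^sub>R axis (e 0) 1) $ s"
          proof (cases "s = e 0")
            case True
            then show ?thesis
              using d_pos by (simp add: A_mult nxt_def idx_e wt_def power2_eq_square axis_def)
          next
            case False
            then have "idx s \<noteq> 0" by (metis e_idx)
            then have "\<not> d dvd idx s" using idx_less[of s] by (auto dest: nat_dvd_not_less[rotated])
            then show ?thesis using False by (simp add: A_mult wt_def axis_def)
          qed
        qed
        moreover have "A 1 *v x - A 0 *v x \<in> V" using 0 inv V by (intro subspace_diff) auto
        ultimately have "inverse (3/5 * x $ e (1 mod d)) *\<^sub>R ((3/5 * x $ e (1 mod d)) *\<^sub>R axis (e 0) 1) \<in> V"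
          using V by (metis subspace_scale)
        then show ?case using 0 by simp
      next
        case (Suc k)
        have "nxt (e (Suc k mod d)) = e (Suc (Suc k) mod d)" by (simp add: nxt_def mod_Suc_eq)
        then have "(A 0 *v x) $ e (Suc k mod d) \<noteq> 0"
          using Suc.prems(2) wt_pos[of 0 "idx (e (Suc k mod d))"] by (simp add: A_mult)
        then show ?case using Suc.IH[of "A 0 *v x"] inv[of 0] Suc.prems(1) by simp
      qed
      have "Suc (idx t + d - 1) mod d = idx t" using idx_less[of t] d_pos by simp
      then have "axis (e 0) 1 \<in> V" using ax[OF x(1), of "idx t + d - 1"] t by simp
      then have top: "axis (e (d mod d)) 1 \<in> V" by simp
      have all: "axis (e (j mod d)) 1 \<in> V" if "j \<le> d" for j
        using that
      proof (induction rule: inc_induct)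
        case base then show ?case by (rule top)
      next
        case (step j)
        let ?s = "e (j mod d)"
        have "A 0 *v axis (e (Suc j mod d)) 1 = ((wt j 0)\<^sup>2) *\<^sub>R axis ?s 1"
        proof (rule vec_eq_iff[THEN iffD2, rule_format])
          fix s
          have "nxt s = e (Suc j mod d) \<longleftrightarrow> s = ?s"
          proof
            assume "nxt s = e (Suc j mod d)"
            then have "Suc (idx s) mod d = Suc j mod d" by (metis idx_e_mod idx_nxt)
            then have "idx s mod d = j mod d" by (simp add: mod_Suc split: if_splits)
            then show "s = ?s" using idx_less[of s] by (metis e_idx mod_less)
          qed (simp add: nxt_def mod_Suc_eq)
          then show "(A 0 *v axis (e (Suc j mod d)) 1) $ s = (((wt j 0)\<^sup>2) *\<^sub>R axis ?s 1) $ s"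
            by (auto simp: A_mult axis_def wt_mod)
        qed
        moreover have "A 0 *v axis (e (Suc j mod d)) 1 \<in> V" using inv step.IH by simp
        ultimately have "inverse ((wt j 0)\<^sup>2) *\<^sub>R (((wt j 0)\<^sup>2) *\<^sub>R axis ?s 1) \<in> V"
          using V by (metis subspace_scale)
        then show ?case using wt_pos[of 0 j] by simp
      qed
      have axes: "axis s 1 \<in> V" for s
        using all[of "idx s"] idx_less[of s] by simp
      have "y \<in> V" for y
      proof -
        have "(\<Sum>s\<in>UNIV. (y $ s) *\<^sub>R axis s 1) \<in> V"
          using axes V by (intro subspace_sum subspace_scale)
        then show ?thesis by (simp add: basis_expansion scalar_mult_eq_scaleR[symmetric])
      qed
      then show False using \<open>V \<noteq> UNIV\<close> by auto
    qed
  qed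
qed

text \<open>
  Coordinate \<open>s\<close> of the composition is moved through the cycle, so it picks up the weights of the
  consecutive phases \<open>idx s, idx s + 1, \<dots>\<close>.
\<close>

lemma word_map_nth:
  "word_map A u w n y $ s
    = (\<Sum>k<n. (q (idx s) w k)\<^sup>2 * offset (idx s + k) (w k)) + (q (idx s) w n)\<^sup>2 * y $ e ((idx s + n) mod d)"
proof (induction n arbitrary: y)
  case 0
  then show ?case using idx_less[of s] by simp
next
  case (Suc n)
  have "nxt (e ((idx s + n) mod d)) = e ((idx s + Suc n) mod d)" by (simp add: nxt_def mod_Suc_eq)
  then have "affine_map A u (w n) y $ e ((idx s + n) mod d)
      = (wt (idx s + n) (w n))\<^sup>2 * y $ e ((idx s + Suc n) mod d) + offset (idx s + n) (w n)"
    by (simp add: affine_map_nth wt_mod offset_mod)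
  then show ?case
    using Suc[of "affine_map A u (w n) y"] by (simp add: q_Suc power_mult_distrib distrib_left)
qed

lemma q2_tendsto_0: "(\<lambda>n. (q p w n)\<^sup>2) \<longlonglongrightarrow> 0"
proof (rule Lim_null_comparison)
  show "(\<lambda>n. (16/25::real) ^ n) \<longlonglongrightarrow> 0" by (rule LIMSEQ_realpow_zero) auto
  show "eventually (\<lambda>n. norm ((q p w n)\<^sup>2) \<le> (16/25) ^ n) sequentially"
    by (simp add: q2_le)
qed

text \<open>
  The base points may vary with \<open>n\<close>: the uniqueness of the attractor needs backward orbits.
\<close>

lemma word_map_tendsto:
  assumes "bounded (range y)"
  shows "(\<lambda>n. word_map A u w n (y n)) \<longlonglongrightarrow> (\<chi> s. coord (idx s) w)"
proof (rule vec_tendstoI)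
  fix s
  obtain B where B: "\<And>n. norm (y n) \<le> B" using assms by (auto simp: bounded_iff)
  have "(\<lambda>n. (q (idx s) w n)\<^sup>2 * y n $ e ((idx s + n) mod d)) \<longlonglongrightarrow> 0"
  proof (rule Lim_null_comparison)
    show "(\<lambda>n. (q (idx s) w n)\<^sup>2 * B) \<longlonglongrightarrow> 0"
      using tendsto_mult_left_zero[OF q2_tendsto_0] .
    show "eventually (\<lambda>n. norm ((q (idx s) w n)\<^sup>2 * y n $ e ((idx s + n) mod d)) \<le> (q (idx s) w n)\<^sup>2 * B) sequentially"
      by (intro always_eventually allI)
        (auto simp: abs_mult intro!: mult_left_mono order_trans[OF component_le_norm_cart B])
  qed
  moreover have "(\<lambda>n. \<Sum>k<n. (q (idx s) w k)\<^sup>2 * offset (idx s + k) (w k)) \<longlonglongrightarrow> coord (idx s) w"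
    unfolding coord_def by (rule summable_LIMSEQ[OF summable_coord])
  ultimately have "(\<lambda>n. (\<Sum>k<n. (q (idx s) w k)\<^sup>2 * offset (idx s + k) (w k))
      + (q (idx s) w n)\<^sup>2 * y n $ e ((idx s + n) mod d)) \<longlonglongrightarrow> coord (idx s) w + 0"
    by (intro tendsto_add)
  then show "(\<lambda>n. word_map A u w n (y n) $ s) \<longlonglongrightarrow> (\<chi> s. coord (idx s) w) $ s"
    by (simp add: word_map_nth)
qed

abbreviation pt :: "(nat \<Rightarrow> nat) \<Rightarrow> real^'n" where "pt \<equiv> coding_map A u"

lemma coding_map_eq: "pt w = (\<chi> s. coord (idx s) w)"
  unfolding coding_map_def by (rule limI[OF word_map_tendsto[of "\<lambda>_. 0"]]) auto

lemma coding_map_nth [simp]: "pt w $ s = coord (idx s) w"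
  by (simp add: coding_map_eq)

lemma continuous_on_coding_map: "continuous_on (codes 2) pt"
  unfolding coding_map_eq[abs_def] by (intro continuous_on_vec_lambda continuous_on_coord)

lemma measurable_coding_map [measurable]: "pt \<in> borel_measurable code_space"
  unfolding code_space_def by (rule borel_measurable_continuous_on_restrict[OF continuous_on_coding_map])

lemma affine_map_coding_map: "affine_map A u i (pt w) = pt (case_nat i w)"
proof (rule vec_eq_iff[THEN iffD2, rule_format])
  fix s
  show "affine_map A u i (pt w) $ s = pt (case_nat i w) $ s"
    using coord_unroll[of "idx s" "case_nat i w"] coord_mod[of "Suc (idx s)" w]
    by (simp add: affine_map_nth idx_nxt)
qed

text \<open>
  An invariant compact set is closed and contains the images of any of its points under all word maps,
  so it contains all coded points; conversely each of its points has a backward orbit inside the set, and the digits of this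
  orbit are a code of the point.
\<close>

lemma attractor_eq: "attractor 2 A u = pt ` codes 2"
  unfolding attractor_def
proof (rule the_equality)
  have "(\<Union>i<2. affine_map A u i ` pt ` codes 2) = pt ` codes 2"
  proof (intro equalityI subsetI)
    fix x assume "x \<in> (\<Union>i<2. affine_map A u i ` pt ` codes 2)"
    then obtain i w where "i < 2" "w \<in> codes 2" "x = affine_map A u i (pt w)" by auto
    then show "x \<in> pt ` codes 2" by (auto simp: affine_map_coding_map)
  next
    fix x assume "x \<in> pt ` codes 2"
    then obtain w where w: "w \<in> codes 2" "x = pt w" by auto
    then have "x = affine_map A u (w 0) (pt (shift w))" by (simp add: affine_map_coding_map case_nat_shift)
    moreover have "w 0 < 2" "shift w \<in> codes 2" using w codes_shift by (auto simp: codes_def)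
    ultimately show "x \<in> (\<Union>i<2. affine_map A u i ` pt ` codes 2)" by auto
  qed
  moreover have "codes 2 \<noteq> {}" by (auto simp: codes_def intro!: exI[of _ "\<lambda>_. 0"])
  moreover have "compact (pt ` codes 2)"
    by (rule compact_continuous_image[OF continuous_on_coding_map compact_codes])
  ultimately show "pt ` codes 2 \<noteq> {} \<and> compact (pt ` codes 2)
      \<and> pt ` codes 2 = (\<Union>i<2. affine_map A u i ` pt ` codes 2)" by simp
next
  fix X assume X: "X \<noteq> {} \<and> compact X \<and> X = (\<Union>i<2. affine_map A u i ` X)"
  have word_lim: "pt w \<in> X" if "\<And>n. word_map A u w n (y n) \<in> X" "\<And>n. y n \<in> X" for w y
  proof (rule closed_sequentially)
    show "closed X" using X compact_imp_closed by blast
    show "(\<lambda>n. word_map A u w n (y n)) \<longlonglongrightarrow> pt w"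
      unfolding coding_map_eq
      by (rule word_map_tendsto) (use X that(2) compact_imp_bounded bounded_subset in \<open>metis image_subsetI\<close>)
  qed (use that(1) in auto)
  show "X = pt ` codes 2"
  proof (intro equalityI subsetI)
    fix x assume "x \<in> X"
    have "\<exists>i. i < 2 \<and> (\<exists>y\<in>X. z = affine_map A u i y)" if "z \<in> X" for z using X that by blast
    then obtain dig prev where step: "\<And>z. z \<in> X \<Longrightarrow> dig z < (2::nat)" "\<And>z. z \<in> X \<Longrightarrow> prev z \<in> X"
        "\<And>z. z \<in> X \<Longrightarrow> z = affine_map A u (dig z) (prev z)" by metis
    define y where "y n = (prev ^^ n) x" for n
    define w where "w n = dig (y n)" for n
    have yX: "y n \<in> X" for n by (induction n) (use \<open>x \<in> X\<close> step(2) in \<open>auto simp: y_def\<close>)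
    have wm: "word_map A u w n (y n) = x" for n
    proof (induction n)
      case (Suc n)
      have "affine_map A u (w n) (y (Suc n)) = y n" using step(3)[OF yX[of n]] by (simp add: w_def y_def)
      then show ?case using Suc by simp
    qed (simp add: y_def)
    have "w \<in> codes 2" using step(1)[OF yX] by (simp add: codes_def w_def)
    moreover have "(\<lambda>n. x) \<longlonglongrightarrow> pt w"
    proof -
      have "bounded (range y)" using X yX compact_imp_bounded bounded_subset by (metis image_subsetI)
      from word_map_tendsto[OF this, of w] show ?thesis by (simp add: wm coding_map_eq)
    qed
    then have "x = pt w" by (simp add: LIMSEQ_const_iff)
    ultimately show "x \<in> pt ` codes 2" by auto
  next
    fix x assume "x \<in> pt ` codes 2"
    then obtain w where w: "w \<in> codes 2" "x = pt w" by auto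
    obtain y0 where y0: "y0 \<in> X" using X by auto
    have "word_map A u w n y \<in> X" if "y \<in> X" for n y
      using that
    proof (induction n arbitrary: y)
      case (Suc n)
      have "w n < 2" using w by (simp add: codes_def)
      then have "affine_map A u (w n) y \<in> X" using X Suc.prems by blast
      then show ?case using Suc.IH by simp
    qed simp
    then show "x \<in> X" unfolding w(2) using y0 by (intro word_lim[of _ "\<lambda>_. y0"]) auto
  qed
qed

end

section \<open>Regularity of the coded measure, and the dimension of the attractor\<close>

text \<open>
  Multiplicative constants disappear in the local dimension.
\<close>

lemma ln_ratio_tendsto_half:
  assumes k: "0 < k" and K: "0 < K"
    and bounds: "\<And>r. 0 < r \<Longrightarrow> r < 1 \<Longrightarrow> k * sqrt r \<le> f r \<and> f r \<le> K * sqrt r"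
  shows "((\<lambda>r. ln (f r) / ln r) \<longlongrightarrow> 1/2) (at_right (0::real))"
proof -
  have inv: "((\<lambda>r::real. c / ln r) \<longlongrightarrow> 0) (at_right 0)" for c :: real
    by (rule tendsto_divide_0[OF tendsto_const filterlim_at_bot_imp_at_infinity[OF ln_at_0]])
  have near: "eventually (\<lambda>r::real. 0 < r \<and> r < 1) (at_right 0)"
    using eventually_at_right_less[of 0] eventually_at_right_field[of "\<lambda>r. r < 1" 0]
    by (auto intro!: eventually_conj exI[of _ 1])
  have est: "ln K / ln r + 1/2 \<le> ln (f r) / ln r \<and> ln (f r) / ln r \<le> ln k / ln r + 1/2"
    if r: "0 < r" "r < 1" for r
  proof -
    have l: "ln r < 0" using r by simp
    have pos: "0 < k * sqrt r" using k r by simp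
    have "ln (k * sqrt r) \<le> ln (f r)" "ln (f r) \<le> ln (K * sqrt r)"
      using bounds[OF r] pos by (auto intro!: ln_mono)
    then have "ln k + ln r / 2 \<le> ln (f r)" "ln (f r) \<le> ln K + ln r / 2"
      using k K r by (auto simp: ln_mult ln_sqrt)
    then have "(ln K + ln r / 2) / ln r \<le> ln (f r) / ln r" "ln (f r) / ln r \<le> (ln k + ln r / 2) / ln r"
      using l by (auto intro!: divide_right_mono_neg)
    then show ?thesis using l by (simp add: add_divide_distrib)
  qed
  show ?thesis
  proof (rule tendsto_sandwich)
    show "eventually (\<lambda>r. ln K / ln r + 1/2 \<le> ln (f r) / ln r) (at_right 0)"
      "eventually (\<lambda>r. ln (f r) / ln r \<le> ln k / ln r + 1/2) (at_right 0)"
      using near est by (auto elim!: eventually_mono)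
    show "((\<lambda>r. ln K / ln r + 1/2) \<longlongrightarrow> 1/2) (at_right 0)" "((\<lambda>r. ln k / ln r + 1/2) \<longlongrightarrow> 1/2) (at_right 0)"
      using tendsto_add[OF inv[of "ln K"] tendsto_const[of "1/2"]] tendsto_add[OF inv[of "ln k"] tendsto_const[of "1/2"]]
      by simp_all
  qed
qed

context phases
begin

definition mass :: "(nat \<Rightarrow> nat) \<Rightarrow> nat \<Rightarrow> real" where
  "mass w n = measure \<mu> (cyl w n)"

lemma mass_eq: "mass w n = (\<Sum>p<d. q p w n) / d"
  by (simp add: mass_def measure_\<mu>_cyl)

lemma mass_0: "mass w 0 = 1" using d_pos by (simp add: mass_eq)

lemma mass_pos: "w \<in> codes 2 \<Longrightarrow> 0 < mass w n"
  unfolding mass_eq using d_pos by (intro divide_pos_pos sum_pos q_pos) (auto simp: lessThan_empty_iff)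

lemma q_le_mass: "p < d \<Longrightarrow> q p w n \<le> d * mass w n"
  using d_pos member_le_sum[of p "{..<d}" "\<lambda>p. q p w n"] by (simp add: mass_eq q_nonneg)

lemma mass_le_some_q: "\<exists>p<d. mass w n \<le> q p w n"
proof (rule ccontr)
  assume "\<not> (\<exists>p<d. mass w n \<le> q p w n)"
  then have "(\<Sum>p<d. q p w n) < (\<Sum>p<d. mass w n)"
    using d_pos by (intro sum_strict_mono) (auto simp: not_le lessThan_empty_iff)
  then show False using d_pos by (simp add: mass_eq)
qed

lemma mass_le: "mass w n \<le> (4/5) ^ n"
  using mass_le_some_q[of w n] q_le order_trans by blast

lemma mass_ge: "w \<in> codes 2 \<Longrightarrow> (1/5) ^ n \<le> mass w n"
proof -
  assume w: "w \<in> codes 2"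
  have "(\<Sum>p<d. (1/5) ^ n) \<le> (\<Sum>p<d. q p w n)" by (intro sum_mono q_ge w)
  then show ?thesis using d_pos by (simp add: mass_eq field_simps)
qed

lemma mass_Suc_ge: "w \<in> codes 2 \<Longrightarrow> mass w n / 5 \<le> mass w (Suc n)"
proof -
  assume w: "w \<in> codes 2"
  have "(\<Sum>p<d. q p w n * (1/5)) \<le> (\<Sum>p<d. q p w (Suc n))"
    unfolding q_Suc using w by (intro sum_mono mult_left_mono wt_ge q_nonneg) (simp add: codes_def)
  then have "(\<Sum>p<d. q p w n) * (1/5) / d \<le> (\<Sum>p<d. q p w (Suc n)) / d"
    unfolding sum_distrib_right[symmetric] by (rule divide_right_mono) simp
  then show ?thesis by (simp add: mass_eq mult.commute)
qed

lemma sum_mass_words: "(\<Sum>v\<in>words n. mass v n) = 1"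
proof -
  interpret prob_space \<mu> by (rule prob_space_\<mu>)
  have "emeasure \<mu> {w\<in>codes 2. True} = (\<Sum>v\<in>{v\<in>words n. True}. emeasure \<mu> (cyl v n))"
    by (rule emeasure_words) (auto simp: depends_on_def)
  then have "1 = ennreal (\<Sum>v\<in>words n. mass v n)"
    using emeasure_space_1 by (simp add: emeasure_eq_measure mass_def sum_ennreal)
  then show ?thesis by (simp add: sum_nonneg mass_def)
qed

end

context cyclic_ifs
begin

text \<open>
  For comparison of balls with cylinders it is enough to know the mass of a cylinder: up to the factor
  \<open>d\<close>, it is the largest of the \<open>q p w n\<close>, whose squares are the contractions in the coordinates.
\<close>

lemma coding_map_near:
  assumes "w \<in> codes 2" "w' \<in> cyl w n"
  shows "dist (pt w) (pt w') \<le> (d * mass w n)\<^sup>2"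
proof -
  have "dist (pt w) (pt w') \<le> (\<Sum>s\<in>UNIV. \<bar>(pt w - pt w') $ s\<bar>)"
    unfolding dist_norm by (rule norm_le_l1_cart)
  also have "\<dots> \<le> (\<Sum>s\<in>UNIV. (q (idx s) w n)\<^sup>2)"
    using coord_near[OF assms] by (intro sum_mono) (simp add: abs_minus_commute)
  also have "\<dots> = (\<Sum>p<d. (q p w n)\<^sup>2)" by (rule sum_idx)
  also have "\<dots> \<le> (\<Sum>p<d. q p w n * (\<Sum>p<d. q p w n))"
  proof (rule sum_mono)
    fix p assume "p \<in> {..<d}"
    then have "q p w n \<le> (\<Sum>p<d. q p w n)" by (intro member_le_sum) (auto simp: q_nonneg)
    then show "(q p w n)\<^sup>2 \<le> q p w n * (\<Sum>p<d. q p w n)"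
      unfolding power2_eq_square by (rule mult_left_mono[OF _ q_nonneg])
  qed
  also have "\<dots> = (\<Sum>p<d. q p w n)\<^sup>2" by (simp add: sum_distrib_right power2_eq_square)
  also have "\<dots> = (d * mass w n)\<^sup>2" using d_pos by (simp add: mass_eq)
  finally show ?thesis .
qed

lemma coding_map_far:
  assumes w: "w \<in> codes 2" "w' \<in> codes 2" and dist: "dist (pt w) (pt w') < 8/25 * (mass w n)\<^sup>2"
  shows "w' \<in> cyl w n"
proof -
  obtain p where p: "p < d" "mass w n \<le> q p w n" using mass_le_some_q by blast
  have "\<bar>coord p w' - coord p w\<bar> = \<bar>(pt w' - pt w) $ e p\<bar>" using p by (simp add: idx_e)
  also have "\<dots> \<le> dist (pt w) (pt w')" by (metis component_le_norm_cart dist_commute dist_norm)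
  also have "\<dots> < 8/25 * (mass w n)\<^sup>2" by (rule dist)
  also have "\<dots> \<le> 8/25 * (q p w n)\<^sup>2" using p(2) mass_pos[OF w(1), of n] by (intro mult_left_mono power_mono) auto
  finally show ?thesis by (rule coord_far[OF w])
qed

lemma measurable_pt: "sets M = sets code_space \<Longrightarrow> pt \<in> borel_measurable M"
  using measurable_cong_sets[of M code_space borel borel] measurable_coding_map by blast

lemma sets_pt_ball: "{w'\<in>codes 2. dist x (pt w') \<le> r} \<in> sets code_space"
proof -
  have "pt -` cball x r \<inter> space code_space \<in> sets code_space" by (intro measurable_sets[OF measurable_coding_map]) auto
  then show ?thesis by (simp add: vimage_def Int_def conj_commute)
qed

lemma measure_cball:
  assumes M: "sets M = sets code_space"
  shows "measure (coding_measure A u M) (cball x r) = measure M {w'\<in>codes 2. dist x (pt w') \<le> r}"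
proof -
  have "space M = codes 2" using sets_eq_imp_space_eq[OF M] by simp
  then show ?thesis unfolding coding_measure_def
    by (subst measure_distr[OF measurable_pt[OF M]]) (auto simp: vimage_def Int_def conj_commute)
qed

abbreviation \<kappa> :: "(real^'n) measure" where "\<kappa> \<equiv> coding_measure A u \<mu>"

lemma prob_space_\<kappa>: "prob_space \<kappa>"
  unfolding coding_measure_def by (rule prob_space.prob_space_distr[OF prob_space_\<mu> measurable_pt]) simp

text \<open>
  Choose \<open>n\<close> least such that the separation scale of \<open>cyl w n\<close> drops to \<open>r\<close>. Then the ball of radius \<open>r\<close>
  lies in the cylinder one generation earlier, which has at most five times the mass.
\<close>

lemma measure_cball_upper:
  assumes w: "w \<in> codes 2" and r: "0 < r"
  shows "measure \<kappa> (cball (pt w) r) \<le> 9 * sqrt r"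
proof -
  interpret prob_space \<mu> by (rule prob_space_\<mu>)
  have "\<exists>n. 8/25 * (mass w n)\<^sup>2 \<le> r"
  proof -
    obtain n where n: "(4/5::real) ^ n < sqrt r" using real_arch_pow_inv[of "sqrt r" "4/5"] r by auto
    have "(mass w n)\<^sup>2 \<le> (sqrt r)\<^sup>2" using n mass_le[of w n] mass_pos[OF w, of n] by (intro power_mono) auto
    then show ?thesis using r by (intro exI[of _ n]) simp
  qed
  then obtain n where n: "8/25 * (mass w n)\<^sup>2 \<le> r" and least: "\<And>k. k < n \<Longrightarrow> r < 8/25 * (mass w k)\<^sup>2"
    using exists_least_iff[of "\<lambda>n. 8/25 * (mass w n)\<^sup>2 \<le> r"] by (auto simp: not_le)
  show ?thesis
  proof (cases n)
    case 0
    then have "1/9 \<le> sqrt r" using n by (intro real_le_rsqrt) (simp add: mass_0 power2_eq_square)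
    moreover have "measure \<kappa> (cball (pt w) r) \<le> 1" by (simp add: measure_cball)
    ultimately show ?thesis by simp
  next
    case (Suc k)
    have "{w'\<in>codes 2. dist (pt w) (pt w') \<le> r} \<subseteq> cyl w k"
      using coding_map_far[OF w] least[of k] Suc by (auto intro: le_less_trans)
    then have "measure \<kappa> (cball (pt w) r) \<le> mass w k"
      unfolding mass_def by (simp add: measure_cball finite_measure_mono)
    moreover have "mass w k / 9 \<le> sqrt r"
    proof (rule real_le_rsqrt)
      have "mass w k \<le> 5 * mass w n" using mass_Suc_ge[OF w, of k] Suc by simp
      then have "(mass w k)\<^sup>2 \<le> (5 * mass w n)\<^sup>2" using mass_pos[OF w, of k] by (intro power_mono) auto
      then show "(mass w k / 9)\<^sup>2 \<le> r" using n r by (simp add: power2_eq_square)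
    qed
    ultimately show ?thesis by simp
  qed
qed

text \<open>
  Choose \<open>n\<close> least such that the diameter bound of \<open>cyl w n\<close> drops to \<open>r\<close>; then the ball contains this
  cylinder, and \<open>n > 0\<close> because \<open>r < 1\<close>.
\<close>

lemma measure_cball_lower:
  assumes w: "w \<in> codes 2" and r: "0 < r" "r < 1"
  shows "1 / (5 * d) * sqrt r \<le> measure \<kappa> (cball (pt w) r)"
proof -
  interpret prob_space \<mu> by (rule prob_space_\<mu>)
  have d: "0 < real d" "1 \<le> real d" using d_pos by auto
  have "\<exists>n. (d * mass w n)\<^sup>2 \<le> r"
  proof -
    obtain n where n: "(4/5::real) ^ n < sqrt r / d" using real_arch_pow_inv[of "sqrt r / d" "4/5"] r d by auto
    have "mass w n < sqrt r / d" using n mass_le[of w n] by linarith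
    then have "d * mass w n \<le> sqrt r" using d by (simp add: pos_less_divide_eq mult.commute)
    then have "(d * mass w n)\<^sup>2 \<le> (sqrt r)\<^sup>2" using mass_pos[OF w, of n] by (intro power_mono) auto
    then show ?thesis using r by auto
  qed
  then obtain n where n: "(d * mass w n)\<^sup>2 \<le> r" and least: "\<And>k. k < n \<Longrightarrow> r < (d * mass w k)\<^sup>2"
    using exists_least_iff[of "\<lambda>n. (d * mass w n)\<^sup>2 \<le> r"] by (auto simp: not_le)
  have "n \<noteq> 0"
  proof
    assume "n = 0"
    then have "(real d)\<^sup>2 < 1" using n r by (simp add: mass_0)
    moreover have "1 \<le> (real d)\<^sup>2" using d by simp
    ultimately show False by simp
  qed
  then obtain k where k: "n = Suc k" by (cases n) auto
  have "sqrt r \<le> d * mass w k"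
    using least[of k] k mass_pos[OF w, of k] by (intro real_le_lsqrt) (auto simp: less_imp_le)
  also have "\<dots> \<le> 5 * d * mass w n" using mass_Suc_ge[OF w, of k] k d mult_left_mono[of "mass w k" "5 * mass w n" d] by simp
  finally have "1 / (5 * d) * sqrt r \<le> mass w n" using d by (simp add: field_simps)
  also have "mass w n \<le> measure \<kappa> (cball (pt w) r)"
    unfolding mass_def using coding_map_near[OF w, of _ n] n cyl_sub sets_pt_ball[of "pt w" r]
    by (auto simp: measure_cball intro!: finite_measure_mono intro: order_trans)
  finally show ?thesis .
qed

lemma emeasure_\<kappa>_attractor: "emeasure \<kappa> (pt ` codes 2) = 1"
proof -
  have c: "compact (pt ` codes 2)"
    by (rule compact_continuous_image[OF continuous_on_coding_map compact_codes])
  have "emeasure \<kappa> (pt ` codes 2) = emeasure \<mu> (pt -` (pt ` codes 2) \<inter> space \<mu>)"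
    unfolding coding_measure_def
    by (rule emeasure_distr[OF measurable_pt]) (auto simp: borel_compact[OF c])
  also have "pt -` (pt ` codes 2) \<inter> space \<mu> = space \<mu>" by auto
  finally show ?thesis using prob_space.emeasure_space_1[OF prob_space_\<mu>] by simp
qed

lemma AE_\<kappa>_attractor: "AE x in \<kappa>. x \<in> pt ` codes 2"
proof -
  have c: "compact (pt ` codes 2)"
    by (rule compact_continuous_image[OF continuous_on_coding_map compact_codes])
  interpret prob_space \<kappa> by (rule prob_space_\<kappa>)
  have "pt ` codes 2 \<in> sets \<kappa>" using borel_compact[OF c] by (simp add: coding_measure_def)
  then show ?thesis using emeasure_\<kappa>_attractor
    by (subst AE_in_set_eq_1) (auto simp: emeasure_eq_measure)
qed

lemma has_dimension_\<kappa>: "has_dimension \<kappa> (ereal (1/2))"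
  unfolding has_dimension_def using AE_\<kappa>_attractor
proof eventually_elim
  case (elim x)
  then obtain w where w: "w \<in> codes 2" "x = pt w" by auto
  have "((\<lambda>r. ln (measure \<kappa> (cball x r)) / ln r) \<longlongrightarrow> 1/2) (at_right 0)"
    unfolding w(2) using d_pos measure_cball_lower[OF w(1)] measure_cball_upper[OF w(1)]
    by (intro ln_ratio_tendsto_half[of "1 / (5 * d)" 9]) auto
  then have l: "((\<lambda>r. ereal (ln (measure \<kappa> (cball x r)) / ln r)) \<longlongrightarrow> ereal (1/2)) (at_right 0)" by simp
  show ?case unfolding upper_local_dim_def lower_local_dim_def
    using lim_imp_Limsup[OF _ l] lim_imp_Liminf[OF _ l] by simp
qed

text \<open>
  Mass distribution principle: each covering set that meets the attractor lies in a ball centred on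
  the attractor of radius its diameter, so its mass is at most 9 times the root of the diameter. For
  diameters at most 1 this is at most 9 times the power with exponent \<open>s < 1/2\<close>.
\<close>

lemma hausdorff_measure_attractor_pos:
  assumes s: "0 < s" "s < 1/2"
  shows "hausdorff_measure s (pt ` codes 2) \<noteq> 0"
proof -
  interpret K: prob_space \<kappa> by (rule prob_space_\<kappa>)
  have upper: "emeasure \<kappa> (cball (pt w) r) \<le> ennreal (9 * sqrt r)" if w: "w \<in> codes 2" and r: "0 \<le> r" for w r
  proof -
    \<comment> \<open>Approaching \<open>r\<close> from the right covers \<open>r = 0\<close>, that is, covering sets with a single point.\<close>
    have "measure \<kappa> (cball (pt w) r) \<le> 9 * sqrt r"
    proof (rule tendsto_lowerbound)
      show "((\<lambda>r'. 9 * sqrt r') \<longlongrightarrow> 9 * sqrt r) (at_right r)"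
        by (intro tendsto_intros)
      have "measure \<kappa> (cball (pt w) r) \<le> 9 * sqrt r'" if "r < r'" for r'
      proof -
        have "measure \<kappa> (cball (pt w) r) \<le> measure \<kappa> (cball (pt w) r')"
          using that by (intro K.finite_measure_mono subset_cball) (auto simp: coding_measure_def)
        also have "\<dots> \<le> 9 * sqrt r'" using that r by (intro measure_cball_upper w) auto
        finally show ?thesis .
      qed
      then show "eventually (\<lambda>r'. measure \<kappa> (cball (pt w) r) \<le> 9 * sqrt r') (at_right r)"
        using eventually_at_right_less[of r] by (auto elim: eventually_mono)
    qed simp
    then show ?thesis by (simp add: K.emeasure_eq_measure ennreal_leI)
  qed
  have "ennreal (1/9) \<le> hausdorff_premeasure s 1 (pt ` codes 2)"
    unfolding hausdorff_premeasure_def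
  proof (rule INF_greatest)
    fix U :: "nat \<Rightarrow> (real^'n) set"
    assume "U \<in> {U. pt ` codes 2 \<subseteq> (\<Union>i. U i) \<and> (\<forall>i. bounded (U i) \<and> diameter (U i) \<le> 1)}"
    then have cov: "pt ` codes 2 \<subseteq> (\<Union>i. U i)" and bd: "\<And>i. bounded (U i)" and diam: "\<And>i. diameter (U i) \<le> 1" by auto
    define V where "V i = (if \<exists>w\<in>codes 2. pt w \<in> U i
      then cball (pt (SOME w. w \<in> codes 2 \<and> pt w \<in> U i)) (diameter (U i)) else {})" for i
    have VU: "U i \<inter> pt ` codes 2 \<subseteq> V i \<and> emeasure \<kappa> (V i) \<le> 9 * ennreal (diameter (U i) powr s)" for i
    proof (cases "\<exists>w\<in>codes 2. pt w \<in> U i")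
      case True
      define w where "w = (SOME w. w \<in> codes 2 \<and> pt w \<in> U i)"
      have w: "w \<in> codes 2" "pt w \<in> U i" using someI_ex[of "\<lambda>w. w \<in> codes 2 \<and> pt w \<in> U i"] True by (auto simp: w_def)
      have V: "V i = cball (pt w) (diameter (U i))" using True by (simp add: V_def w_def)
      have D: "0 \<le> diameter (U i)" by (rule diameter_ge_0[OF bd])
      have "sqrt (diameter (U i)) \<le> diameter (U i) powr s"
      proof (cases "diameter (U i) = 0")
        case False
        then have "sqrt (diameter (U i)) = diameter (U i) powr (1/2)" using D by (simp add: powr_half_sqrt)
        also have "\<dots> \<le> diameter (U i) powr s" using s diam[of i] D False by (intro powr_mono') auto
        finally show ?thesis .
      qed simp
      then have "ennreal (9 * sqrt (diameter (U i))) \<le> 9 * ennreal (diameter (U i) powr s)"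
        by (subst ennreal_mult') (auto intro!: mult_left_mono ennreal_leI simp: ennreal_numeral)
      moreover have "U i \<subseteq> V i"
        unfolding V using diameter_bounded_bound[OF bd w(2)] by auto
      ultimately show ?thesis using upper[OF w(1) D] unfolding V by (auto intro: order_trans)
    qed (auto simp: V_def)
    have Vs: "range V \<subseteq> sets \<kappa>" by (auto simp: V_def coding_measure_def)
    have "1 \<le> emeasure \<kappa> (\<Union>i. V i)"
      unfolding emeasure_\<kappa>_attractor[symmetric]
    proof (rule emeasure_mono)
      show "pt ` codes 2 \<subseteq> (\<Union>i. V i)" using cov VU by blast
      show "(\<Union>i. V i) \<in> sets \<kappa>" using Vs by auto
    qed
    also have "\<dots> \<le> (\<Sum>i. emeasure \<kappa> (V i))" by (rule emeasure_subadditive_countably[OF Vs])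
    also have "\<dots> \<le> (\<Sum>i. 9 * ennreal (diameter (U i) powr s))" using VU by (intro suminf_le) auto
    also have "\<dots> = 9 * (\<Sum>i. ennreal (diameter (U i) powr s))" by (rule ennreal_suminf_cmult)
    finally have "ennreal (1/9) * 1 \<le> ennreal (1/9) * (9 * (\<Sum>i. ennreal (diameter (U i) powr s)))"
      by (rule mult_left_mono) simp
    also have "\<dots> = (\<Sum>i. ennreal (diameter (U i) powr s))"
      unfolding mult.assoc[symmetric] ennreal_numeral[symmetric] by (simp add: ennreal_mult[symmetric] del: ennreal_numeral)
    finally show "ennreal (1/9) \<le> (\<Sum>i. ennreal (diameter (U i) powr s))" by simp
  qed
  also have "\<dots> \<le> hausdorff_measure s (pt ` codes 2)"
    unfolding hausdorff_measure_def by (rule SUP_upper) simp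
  finally show ?thesis by auto
qed

lemma diameter_cyl_image: "w \<in> codes 2 \<Longrightarrow> bounded (pt ` cyl w n) \<and> diameter (pt ` cyl w n) \<le> (d * mass w n)\<^sup>2"
proof -
  assume w: "w \<in> codes 2"
  have near: "dist (pt v) (pt v') \<le> (d * mass w n)\<^sup>2" if v: "v \<in> cyl w n" "v' \<in> cyl w n" for v v'
  proof -
    have "cyl v n = cyl w n" using v(1) by (intro cyl_eqI) (simp add: cyl_def)
    moreover from this have "mass v n = mass w n" by (simp add: mass_def)
    ultimately show ?thesis using coding_map_near[of v v' n] v cyl_sub by auto
  qed
  have "bounded (pt ` cyl w n)" using near by (auto simp: bounded_two_points)
  moreover have "diameter (pt ` cyl w n) \<le> (d * mass w n)\<^sup>2"
    using near by (intro diameter_le) (auto simp: dist_norm)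
  ultimately show ?thesis by simp
qed

text \<open>
  Cover by the cylinders of length \<open>n\<close>: up to a constant the \<open>s\<close>-th power of the diameter is at most
  \<open>mass\<close> to the power \<open>2 s\<close>, and since the masses sum to one and are at most \<open>(4/5)\<^sup>n\<close>, the total is
  at most a constant times \<open>(4/5)\<close> to the power \<open>(2 s - 1) n\<close>.
\<close>

lemma hausdorff_measure_attractor_0:
  assumes s: "1/2 < s"
  shows "hausdorff_measure s (pt ` codes 2) = 0"
proof -
  have d: "0 < real d" using d_pos by simp
  have "hausdorff_premeasure s \<delta> (pt ` codes 2) = 0" if \<delta>: "0 < \<delta>" for \<delta>
  proof -
    define C where "C = real d powr (2 * s)"
    have est: "hausdorff_premeasure s \<delta> (pt ` codes 2) \<le> ennreal (C * ((4/5) powr (2 * s - 1)) ^ n)"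
      if n: "(d * (4/5) ^ n)\<^sup>2 \<le> \<delta>" for n
    proof -
      obtain g where g: "bij_betw g {..<card (words n)} (words n)"
        using ex_bij_betw_nat_finite[OF finite_words] by (auto simp: atLeast0LessThan)
      define U where "U i = (if i < card (words n) then pt ` cyl (g i) n else {})" for i
      have gw: "g i \<in> words n" "g i \<in> codes 2" if "i < card (words n)" for i
        using bij_betwE[OF g] that words_codes by auto
      have "pt ` codes 2 \<subseteq> (\<Union>i. U i)"
      proof clarify
        fix w assume "w \<in> codes 2"
        then obtain v where v: "v \<in> words n" "w \<in> cyl v n" using ex1_word[of w n] by auto
        then obtain i where "i < card (words n)" "g i = v" using bij_betw_imp_surj_on[OF g] by (metis imageE lessThan_iff)
        then show "pt w \<in> (\<Union>i. U i)" using v by (auto simp: U_def)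
      qed
      moreover have "bounded (U i) \<and> diameter (U i) \<le> \<delta>" for i
      proof (cases "i < card (words n)")
        case True
        have "(d * mass (g i) n)\<^sup>2 \<le> (d * (4/5) ^ n)\<^sup>2"
          using mass_le mass_pos[OF gw(2)[OF True], of n] by (intro power_mono mult_left_mono) auto
        then show ?thesis using diameter_cyl_image[OF gw(2)[OF True], of n] n True by (auto simp: U_def)
      qed (use \<delta> in \<open>auto simp: U_def\<close>)
      ultimately have "hausdorff_premeasure s \<delta> (pt ` codes 2) \<le> (\<Sum>i. ennreal (diameter (U i) powr s))"
        unfolding hausdorff_premeasure_def by (intro INF_lower) auto
      also have "\<dots> = (\<Sum>i<card (words n). ennreal (diameter (U i) powr s))"
        by (rule suminf_finite) (auto simp: U_def)
      also have "\<dots> \<le> (\<Sum>i<card (words n). ennreal (C * ((4/5) powr (2 * s - 1)) ^ n * mass (g i) n))"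
      proof (intro sum_mono ennreal_leI)
        fix i assume "i \<in> {..<card (words n)}"
        then have i: "i < card (words n)" by simp
        have mp: "0 < mass (g i) n" by (rule mass_pos[OF gw(2)[OF i]])
        have "diameter (U i) powr s \<le> ((d * mass (g i) n)\<^sup>2) powr s"
          using diameter_cyl_image[OF gw(2)[OF i], of n] i s
          by (intro powr_mono2) (auto simp: U_def diameter_ge_0)
        also have "((d * mass (g i) n)\<^sup>2) powr s = (d * mass (g i) n) powr (2 * s)"
          using mp d by (simp add: powr_powr[symmetric] powr_numeral)
        also have "\<dots> = C * (mass (g i) n powr (2 * s - 1) * mass (g i) n)"
          using mp d by (simp add: powr_mult C_def powr_diff)
        also have "\<dots> \<le> C * (((4/5) ^ n) powr (2 * s - 1) * mass (g i) n)"
          using mp mass_le s by (intro mult_left_mono mult_right_mono powr_mono2) (auto simp: C_def)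
        also have "((4/5::real) ^ n) powr (2 * s - 1) = ((4/5) powr (2 * s - 1)) ^ n"
          by (simp add: powr_realpow[symmetric] powr_powr mult.commute)
        finally show "diameter (U i) powr s \<le> C * ((4/5) powr (2 * s - 1)) ^ n * mass (g i) n" by (simp add: mult.assoc)
      qed
      also have "\<dots> = ennreal (\<Sum>i<card (words n). C * ((4/5) powr (2 * s - 1)) ^ n * mass (g i) n)"
        using mass_pos gw by (intro sum_ennreal) (auto simp: C_def less_imp_le)
      also have "(\<Sum>i<card (words n). C * ((4/5) powr (2 * s - 1)) ^ n * mass (g i) n) = C * ((4/5) powr (2 * s - 1)) ^ n"
        using sum.reindex_bij_betw[OF g, of "\<lambda>v. mass v n"] sum_mass_words[of n] by (simp add: sum_distrib_left[symmetric])
      finally show ?thesis .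
    qed
    have ev: "eventually (\<lambda>n. (d * (4/5) ^ n)\<^sup>2 \<le> \<delta>) sequentially"
    proof -
      have "(\<lambda>n. (4/5::real) ^ n) \<longlonglongrightarrow> 0" by (rule LIMSEQ_realpow_zero) auto
      from tendsto_power[OF tendsto_mult[OF tendsto_const[of "real d"] this], of 2]
      have "(\<lambda>n. (d * (4/5::real) ^ n)\<^sup>2) \<longlonglongrightarrow> 0" by simp
      from order_tendstoD(2)[OF this \<delta>] show ?thesis by (auto elim: eventually_mono)
    qed
    have "(\<lambda>n. ((4/5::real) powr (2 * s - 1)) ^ n) \<longlonglongrightarrow> 0"
      using s powr_less_mono'[of "4/5" 0 "2 * s - 1"] by (intro LIMSEQ_realpow_zero) auto
    from tendsto_mult[OF tendsto_const[of C] this]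
    have "(\<lambda>n. ennreal (C * ((4/5) powr (2 * s - 1)) ^ n)) \<longlonglongrightarrow> ennreal 0" by (intro tendsto_ennrealI) simp
    then have "hausdorff_premeasure s \<delta> (pt ` codes 2) \<le> ennreal 0"
      by (rule tendsto_lowerbound) (use ev est in \<open>auto elim: eventually_mono\<close>)
    then show ?thesis by simp
  qed
  then show ?thesis unfolding hausdorff_measure_def by (auto intro!: SUP_eq_const simp: bot_ennreal)
qed

lemma hausdorff_dimension_attractor: "hausdorff_dimension (attractor 2 A u) = ereal (1/2)"
  unfolding attractor_eq hausdorff_dimension_def
proof (rule antisym)
  show "ereal (1/2) \<le> (INF s\<in>{s. 0 < s \<and> hausdorff_measure s (pt ` codes 2) = 0}. ereal s)"
    using hausdorff_measure_attractor_pos by (intro INF_greatest) (force simp: not_less)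
  show "(INF s\<in>{s. 0 < s \<and> hausdorff_measure s (pt ` codes 2) = 0}. ereal s) \<le> ereal (1/2)"
  proof (rule ereal_le_epsilon2)
    fix \<epsilon> :: real assume \<epsilon>: "0 < \<epsilon>"
    have "(INF s\<in>{s. 0 < s \<and> hausdorff_measure s (pt ` codes 2) = 0}. ereal s) \<le> ereal (1/2 + \<epsilon>)"
      using \<epsilon> hausdorff_measure_attractor_0[of "1/2 + \<epsilon>"] by (intro INF_lower) auto
    then show "(INF s\<in>{s. 0 < s \<and> hausdorff_measure s (pt ` codes 2) = 0}. ereal s) \<le> ereal (1/2) + ereal \<epsilon>" by simp
  qed
qed

end

section \<open>Uniqueness of the measure of maximal dimension\<close>

text \<open>
  A null ball would satisfy the bound trivially, although the convention \<open>ln 0 = 0\<close> makes its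
  logarithmic quotient \<open>0\<close>; hence the case distinction in the proof.
\<close>

lemma lower_local_dim_ball_bound:
  assumes dim: "ereal b < lower_local_dim \<nu> x"
    and pos: "\<And>n. 0 < r n" and lim: "r \<longlonglongrightarrow> 0"
  shows "eventually (\<lambda>n. measure \<nu> (cball x (r n)) \<le> r n powr b) sequentially"
proof -
  have "eventually (\<lambda>r. b < ln (measure \<nu> (cball x r)) / ln r) (at_right 0)"
    using less_LiminfD[OF dim[unfolded lower_local_dim_def]] by simp
  moreover have "filterlim r (at_right 0) sequentially"
  proof -
    have "r n \<in> {0<..} \<and> r n \<noteq> 0" for n using pos[of n] by simp
    then show ?thesis unfolding filterlim_at using lim by simp
  qed
  ultimately have "eventually (\<lambda>n. b < ln (measure \<nu> (cball x (r n))) / ln (r n)) sequentially"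
    by (rule eventually_compose_filterlim)
  moreover have "eventually (\<lambda>n. r n < 1) sequentially" using order_tendstoD(2)[OF lim, of 1] by simp
  ultimately show ?thesis
  proof eventually_elim
    case (elim n)
    have "ln (r n) < 0" using elim(2) pos by simp
    then have l: "ln (measure \<nu> (cball x (r n))) \<le> b * ln (r n)"
      using elim(1) by (simp add: neg_less_divide_eq)
    show ?case
    proof (cases "measure \<nu> (cball x (r n)) = 0")
      case False
      then have "0 < measure \<nu> (cball x (r n))" by (simp add: zero_less_measure_iff)
      then have "measure \<nu> (cball x (r n)) = exp (ln (measure \<nu> (cball x (r n))))" by simp
      also have "\<dots> \<le> exp (b * ln (r n))" using l by simp
      also have "\<dots> = r n powr b" using pos[of n] by (simp add: powr_def)
      finally show ?thesis .
    qed simp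
  qed
qed

text \<open>
  Here positive mass has to be assumed: with \<open>ln 0 = 0\<close>, a null ball would have quotient \<open>0\<close> and yield no
  lower bound.
\<close>

lemma upper_local_dim_ball_bound:
  assumes dim: "upper_local_dim \<nu> x < ereal b"
    and pos: "\<And>n. 0 < r n" and lim: "r \<longlonglongrightarrow> 0"
    and mass: "\<And>n. 0 < measure \<nu> (cball x (r n))"
  shows "eventually (\<lambda>n. r n powr b \<le> measure \<nu> (cball x (r n))) sequentially"
proof -
  have "eventually (\<lambda>r. ln (measure \<nu> (cball x r)) / ln r < b) (at_right 0)"
    using Limsup_lessD[OF dim[unfolded upper_local_dim_def]] by simp
  moreover have "filterlim r (at_right 0) sequentially"
  proof -
    have "r n \<in> {0<..} \<and> r n \<noteq> 0" for n using pos[of n] by simp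
    then show ?thesis unfolding filterlim_at using lim by simp
  qed
  ultimately have "eventually (\<lambda>n. ln (measure \<nu> (cball x (r n))) / ln (r n) < b) sequentially"
    by (rule eventually_compose_filterlim)
  moreover have "eventually (\<lambda>n. r n < 1) sequentially" using order_tendstoD(2)[OF lim, of 1] by simp
  ultimately show ?thesis
  proof eventually_elim
    case (elim n)
    have "ln (r n) < 0" using elim(2) pos by simp
    then have l: "b * ln (r n) \<le> ln (measure \<nu> (cball x (r n)))"
      using elim(1) by (simp add: neg_divide_less_eq)
    have "r n powr b = exp (b * ln (r n))" using pos[of n] by (simp add: powr_def)
    also have "\<dots> \<le> exp (ln (measure \<nu> (cball x (r n))))" using l by simp
    also have "\<dots> = measure \<nu> (cball x (r n))" using mass[of n] by simp
    finally show ?case .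
  qed
qed

text \<open>
  Lowering the exponent from \<open>1/2\<close> to \<open>1/2 - \<epsilon>\<close> costs a factor \<open>y\<close> to the power \<open>- 2 \<epsilon>\<close>, which is at most
  \<open>25\<close> to the power \<open>\<epsilon> n\<close>.
\<close>

lemma powr_half_minus_le:
  assumes y: "(1/5) ^ n \<le> y" and \<epsilon>: "0 < \<epsilon>"
  shows "(y\<^sup>2) powr (1/2 - \<epsilon>) \<le> exp (2 * \<epsilon> * ln 5 * real n) * (y :: real)"
proof -
  have y0: "0 < y" using y by (rule less_le_trans[rotated]) simp
  have "(y\<^sup>2) powr (1/2 - \<epsilon>) = exp ((1 - 2 * \<epsilon>) * ln y)"
    using y0 by (simp add: powr_def ln_realpow algebra_simps)
  also have "\<dots> = exp (2 * \<epsilon> * (- ln y)) * y"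
    using y0 by (simp add: left_diff_distrib exp_diff exp_minus field_simps)
  also have "\<dots> \<le> exp (2 * \<epsilon> * ln 5 * real n) * y"
  proof -
    have "ln ((1/5) ^ n) \<le> ln y" using y by (intro ln_mono) auto
    then have "- ln y \<le> real n * ln 5" by (simp add: ln_realpow ln_div)
    then have "2 * \<epsilon> * (- ln y) \<le> 2 * \<epsilon> * (real n * ln 5)" using \<epsilon> by (intro mult_left_mono) auto
    then show ?thesis using y0 by (simp add: ac_simps)
  qed
  finally show ?thesis .
qed

context cyclic_ifs
begin

lemma mass_tendsto_0: "(\<lambda>n. mass w n) \<longlonglongrightarrow> 0"
proof (rule Lim_null_comparison)
  show "(\<lambda>n. (4/5::real) ^ n) \<longlonglongrightarrow> 0" by (rule LIMSEQ_realpow_zero) auto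
  have "0 \<le> mass w n" for n by (simp add: mass_def)
  then show "eventually (\<lambda>n. norm (mass w n) \<le> (4/5) ^ n) sequentially" by (simp add: mass_le)
qed

text \<open>
  A ball of radius \<open>(d * mass w n)\<^sup>2\<close> contains \<open>cyl w n\<close>, so a lower local dimension of at least \<open>1/2\<close>
  bounds the \<open>M\<close>-mass of the cylinder by its \<open>\<mu>\<close>-mass up to subexponential factors.
\<close>

lemma unique_dimension_half:
  assumes inv: "shift_invariant_prob 2 M" and dim: "has_dimension (coding_measure A u M) (ereal (1/2))"
  shows "M = \<mu>"
proof (rule unique_invariant[OF inv])
  fix \<delta> :: real assume \<delta>: "0 < \<delta>"
  have sets: "sets M = sets code_space" and sp: "space M = codes 2" and pr: "prob_space M"
    using inv by (auto simp: shift_invariant_prob_def code_space_def)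
  interpret M: prob_space M by (rule pr)
  have d: "1 \<le> real d" using d_pos by simp
  have "AE w in M. upper_local_dim (coding_measure A u M) (pt w) = ereal (1/2)
      \<and> lower_local_dim (coding_measure A u M) (pt w) = ereal (1/2)"
    using dim AE_distrD[OF measurable_pt[OF sets]] unfolding has_dimension_def coding_measure_def by blast
  then show "AE w in M. eventually (\<lambda>n. measure M (cyl w n) \<le> exp (\<delta> * real n) * measure \<mu> (cyl w n)) sequentially"
    using AE_space[of M]
  proof eventually_elim
    case (elim w)
    then have w: "w \<in> codes 2" by (simp add: sp)
    define \<epsilon> where "\<epsilon> = \<delta> / (4 * ln 5)"
    have \<epsilon>: "0 < \<epsilon>" using \<delta> by (simp add: \<epsilon>_def)
    have "eventually (\<lambda>n. measure (coding_measure A u M) (cball (pt w) ((d * mass w n)\<^sup>2)) \<le> ((d * mass w n)\<^sup>2) powr (1/2 - \<epsilon>)) sequentially"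
    proof (rule lower_local_dim_ball_bound)
      show "ereal (1/2 - \<epsilon>) < lower_local_dim (coding_measure A u M) (pt w)" using elim \<epsilon> by simp
      show "0 < (d * mass w n)\<^sup>2" for n using mass_pos[OF w, of n] d_pos by simp
      show "(\<lambda>n. (d * mass w n)\<^sup>2) \<longlonglongrightarrow> 0"
        using tendsto_power[OF tendsto_mult[OF tendsto_const mass_tendsto_0], of "real d" w 2] by simp
    qed
    moreover have "eventually (\<lambda>n. d \<le> exp (\<delta> / 2 * real n)) sequentially"
    proof (rule eventually_sequentiallyI)
      fix n assume "nat \<lceil>2 * ln d / \<delta>\<rceil> \<le> n"
      then have "2 * ln d / \<delta> \<le> real n" by linarith
      then have "ln d \<le> \<delta> / 2 * real n" using \<delta> by (simp add: field_simps)
      then have "exp (ln d) \<le> exp (\<delta> / 2 * real n)" by simp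
      then show "d \<le> exp (\<delta> / 2 * real n)" using d_pos by simp
    qed
    ultimately show ?case
    proof eventually_elim
      case (elim n)
      have "measure M (cyl w n) \<le> measure (coding_measure A u M) (cball (pt w) ((d * mass w n)\<^sup>2))"
        unfolding measure_cball[OF sets]
        using coding_map_near[OF w] cyl_sub sets_pt_ball[of "pt w" "(d * mass w n)\<^sup>2"]
        by (intro M.finite_measure_mono) (auto simp: sets intro: order_trans dest: subsetD[OF cyl_sub])
      also note elim(1)
      also have "((d * mass w n)\<^sup>2) powr (1/2 - \<epsilon>) \<le> exp (2 * \<epsilon> * ln 5 * real n) * (d * mass w n)"
      proof (rule powr_half_minus_le[OF _ \<epsilon>])
        show "(1/5) ^ n \<le> d * mass w n"
          using mass_ge[OF w, of n] mult_right_mono[OF d, of "mass w n"] mass_pos[OF w, of n] by linarith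
      qed
      also have "2 * \<epsilon> * ln 5 * real n = \<delta> / 2 * real n" by (simp add: \<epsilon>_def)
      also have "exp (\<delta> / 2 * real n) * (d * mass w n) \<le> exp (\<delta> / 2 * real n) * (exp (\<delta> / 2 * real n) * mass w n)"
        using elim(2) mass_pos[OF w, of n] by (intro mult_left_mono mult_right_mono) auto
      also have "\<dots> = exp (\<delta> * real n) * measure \<mu> (cyl w n)"
        by (simp add: mass_def exp_add[symmetric] mult.assoc[symmetric])
      finally show ?case .
    qed
  qed
qed

end

section \<open>The projection to the special coordinate\<close>

context phases
begin

lemma AE_\<mu>_imp_\<nu>:
  assumes "AE w in \<mu>. P w" "p < d"
  shows "AE w in \<nu> p. P w"
proof -
  obtain N where N: "{w\<in>space \<mu>. \<not> P w} \<subseteq> N" "emeasure \<mu> N = 0" "N \<in> sets \<mu>"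
    using AE_E[OF assms(1)] by blast
  then have "(\<Sum>p<d. emeasure (\<nu> p) N) / of_nat d = 0" using emeasure_\<mu>[of N] by simp
  then have "(\<Sum>p<d. emeasure (\<nu> p) N) = 0"
    by (simp add: ennreal_divide_eq_0_iff)
  then have "emeasure (\<nu> p) N = 0" using assms(2) by simp
  then show ?thesis using N by (intro AE_I[of _ _ N]) auto
qed

lemma measure_\<nu>_words:
  assumes "depends_on n P"
  shows "measure (\<nu> p) {w\<in>codes 2. P w} = (\<Sum>v\<in>{v\<in>words n. P v}. q p v n)"
proof -
  have "emeasure (\<nu> p) {w\<in>codes 2. P w} = (\<Sum>v\<in>{v\<in>words n. P v}. ennreal (q p v n))"
    unfolding emeasure_words[OF sets_\<nu> assms] by (simp add: emeasure_\<nu>_cyl)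
  also have "\<dots> = ennreal (\<Sum>v\<in>{v\<in>words n. P v}. q p v n)" by (rule sum_ennreal) (rule q_nonneg)
  finally show ?thesis by (simp add: measure_def sum_nonneg q_nonneg)
qed

text \<open>
  An almost surely eventual property has probability tending to one, so it cannot have probability
  tending to zero along a subsequence.
\<close>

lemma \<nu>_not_eventually:
  assumes dep: "\<And>n. depends_on n (P n)"
    and ae: "AE w in \<nu> p. eventually (\<lambda>n. P n w) sequentially"
    and small: "\<And>k. measure (\<nu> p) {w\<in>codes 2. P (g k) w} \<le> b k" "b \<longlonglongrightarrow> 0"
    and g: "strict_mono g"
  shows False
proof -
  interpret prob_space "\<nu> p" by (rule prob_space_\<nu>)
  have ms: "{w\<in>codes 2. P n w} \<in> events" "{w\<in>codes 2. \<not> P n w} \<in> events" for n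
    using depends_on_sets[OF dep] depends_on_sets[OF depends_on_compose[OF dep, where h=Not]] by auto
  have "(\<lambda>n. prob {w\<in>space (\<nu> p). \<not> P n w}) \<longlonglongrightarrow> 0"
    using ae by (rule measure_not_eventually_tendsto_0) (use ms in simp)
  from LIMSEQ_subseq_LIMSEQ[OF this g] have "(\<lambda>k. prob {w\<in>codes 2. \<not> P (g k) w}) \<longlonglongrightarrow> 0"
    by (simp add: comp_def)
  from tendsto_add[OF small(2) this] have "(\<lambda>k. b k + prob {w\<in>codes 2. \<not> P (g k) w}) \<longlonglongrightarrow> 0" by simp
  moreover have "1 \<le> b k + prob {w\<in>codes 2. \<not> P (g k) w}" for k
  proof -
    have "prob {w\<in>codes 2. \<not> P (g k) w} = 1 - prob {w\<in>codes 2. P (g k) w}"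
      using prob_compl[OF ms(1)[of "g k"]] by (simp add: set_diff_eq conj_commute cong: conj_cong)
    then show ?thesis using small(1)[of k] by simp
  qed
  ultimately have "(1::real) \<le> 0" by (intro tendsto_lowerbound[where a=1]) auto
  then show False by simp
qed

text \<open>
  The Hellinger affinity of the digit laws at the consecutive phases \<open>p\<close> and \<open>p + 1\<close>. It is at most one,
  and strictly below one at least once per period, so that the affinity of \<open>\<nu> 0\<close> and \<open>\<nu> 1\<close> on words decays
  exponentially.
\<close>

definition hellinger :: "nat \<Rightarrow> real" where
  "hellinger p = (\<Sum>i<2. sqrt (wt p i * wt (Suc p) i))"

lemma hellinger_nonneg: "0 \<le> hellinger p" unfolding hellinger_def by (intro sum_nonneg) (simp add: wt_nonneg)

lemma hellinger_le_1: "hellinger p \<le> 1"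
proof -
  have "hellinger p \<le> (\<Sum>i<2. (wt p i + wt (Suc p) i) / 2)"
    unfolding hellinger_def by (intro sum_mono arith_geo_mean_sqrt wt_nonneg)
  also have "\<dots> = 1" using sum_wt[of p] sum_wt[of "Suc p"] by (simp add: sum.distrib sum_divide_distrib[symmetric])
  finally show ?thesis .
qed

lemma hellinger_special:
  assumes "d dvd p" shows "hellinger p \<le> 49/50"
proof -
  have "\<not> d dvd Suc p"
  proof
    assume "d dvd Suc p"
    then have "d dvd 1" using assms dvd_add_right_iff[of d p 1] by simp
    then show False using two_le_d by simp
  qed
  then have "hellinger p = sqrt (1/10) + sqrt (4/10)"
    using assms by (simp add: hellinger_def wt_def numeral_2_eq_2)
  moreover have "sqrt (1/10) \<le> 32/100" "sqrt (4/10) \<le> 64/100"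
    by (rule real_le_lsqrt; simp add: power2_eq_square)+
  ultimately show ?thesis by simp
qed

lemma sum_words_hellinger: "(\<Sum>v\<in>words n. sqrt (q p v n * q (Suc p) v n)) = (\<Prod>k<n. hellinger (p + k))"
proof (induction n arbitrary: p)
  case 0 then show ?case by simp
next
  case (Suc n)
  have "(\<Sum>v\<in>words (Suc n). sqrt (q p v (Suc n) * q (Suc p) v (Suc n)))
      = (\<Sum>i<2. \<Sum>v\<in>words n. sqrt (wt p i * wt (Suc p) i) * sqrt (q (Suc p) v n * q (Suc (Suc p)) v n))"
    unfolding sum_words_Suc q_case_nat by (simp add: real_sqrt_mult ac_simps)
  also have "\<dots> = hellinger p * (\<Prod>k<n. hellinger (Suc p + k))"
    unfolding Suc[of "Suc p", symmetric] by (simp add: hellinger_def sum_distrib_left sum_distrib_right sum.swap[of _ "words n"])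
  also have "\<dots> = (\<Prod>k<Suc n. hellinger (p + k))" by (subst prod.lessThan_Suc_shift) simp
  finally show ?case .
qed

lemma prod_lessThan_add:
  "(\<Prod>k<a + b. f k) = (\<Prod>k<a. f k) * (\<Prod>k<b. f (a + k) :: real)" for a b :: nat
  by (induction b) (auto simp: ac_simps)

lemma prod_hellinger_le: "(\<Prod>k<N * d. hellinger k) \<le> (49/50) ^ N"
proof (induction N)
  case (Suc N)
  obtain d' where d': "d = Suc d'" using d_pos by (cases d) auto
  have "(\<Prod>k<d. hellinger (N * d + k)) = hellinger (N * d) * (\<Prod>k<d'. hellinger (N * d + Suc k))"
    unfolding d' by (subst prod.lessThan_Suc_shift) simp
  also have "\<dots> \<le> 49/50 * 1"
    by (intro mult_mono hellinger_special prod_le_1 prod_nonneg) (auto simp: hellinger_nonneg hellinger_le_1)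
  finally have "(\<Prod>k<d. hellinger (N * d + k)) \<le> 49/50" by simp
  then have "(\<Prod>k<N * d. hellinger k) * (\<Prod>k<d. hellinger (N * d + k)) \<le> (49/50) ^ N * (49/50)"
    using Suc by (intro mult_mono prod_nonneg) (auto simp: hellinger_nonneg)
  moreover have "Suc N * d = N * d + d" by simp
  ultimately show ?case by (simp only: prod_lessThan_add power_Suc mult.commute)
qed simp

text \<open>
  On the event in question \<open>q 1\<close> is at most \<open>sqrt K\<close> times the geometric mean of \<open>q 0\<close> and \<open>q 1\<close>, and the
  sum of the geometric means over the words is the product of the affinities.
\<close>

lemma \<nu>_1_small:
  assumes "0 \<le> K"
  shows "measure (\<nu> 1) {w\<in>codes 2. q 1 w (N * d) \<le> K * q 0 w (N * d)} \<le> sqrt K * (49/50) ^ N"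
proof -
  let ?n = "N * d"
  have dep: "depends_on ?n (\<lambda>w. q 1 w ?n \<le> K * q 0 w ?n)"
    by (rule depends_on_compose2[where h="\<lambda>x y. x \<le> K * y"]) (auto simp: depends_on_def intro: q_cong)
  have "measure (\<nu> 1) {w\<in>codes 2. q 1 w ?n \<le> K * q 0 w ?n} = (\<Sum>v\<in>{v\<in>words ?n. q 1 v ?n \<le> K * q 0 v ?n}. q 1 v ?n)"
    by (rule measure_\<nu>_words[OF dep])
  also have "\<dots> \<le> (\<Sum>v\<in>{v\<in>words ?n. q 1 v ?n \<le> K * q 0 v ?n}. sqrt K * sqrt (q 0 v ?n * q (Suc 0) v ?n))"
  proof (rule sum_mono)
    fix v assume "v \<in> {v\<in>words ?n. q 1 v ?n \<le> K * q 0 v ?n}"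
    then have "q 1 v ?n * q 1 v ?n \<le> K * q 0 v ?n * q 1 v ?n"
      by (intro mult_right_mono q_nonneg) auto
    then have "q 1 v ?n \<le> sqrt (K * q 0 v ?n * q 1 v ?n)"
      by (intro real_le_rsqrt) (simp add: power2_eq_square)
    then show "q 1 v ?n \<le> sqrt K * sqrt (q 0 v ?n * q (Suc 0) v ?n)"
      by (simp add: real_sqrt_mult mult.assoc)
  qed
  also have "\<dots> \<le> (\<Sum>v\<in>words ?n. sqrt K * sqrt (q 0 v ?n * q (Suc 0) v ?n))"
    using assms by (intro sum_mono2 finite_words) (auto simp: q_nonneg)
  also have "\<dots> = sqrt K * (\<Prod>k<?n. hellinger k)"
    using sum_words_hellinger[where p=0 and n="?n"] by (simp add: sum_distrib_left[symmetric])
  also have "\<dots> \<le> sqrt K * (49/50) ^ N" using assms by (intro mult_left_mono prod_hellinger_le) auto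
  finally show ?thesis .
qed

text \<open>
  Markov's inequality for \<open>mass / q 0\<close>, whose mean under \<open>\<nu> 0\<close> is the sum of the masses of all words.
\<close>

lemma \<nu>_0_small:
  assumes "0 < K"
  shows "measure (\<nu> 0) {w\<in>codes 2. K * q 0 w n \<le> mass w n} \<le> 1 / K"
proof -
  have dm: "depends_on n (\<lambda>w. mass w n)"
    unfolding mass_def by (rule depends_on_cyl_center)
  have dq: "depends_on n (\<lambda>w. q 0 w n)" by (auto simp: depends_on_def intro: q_cong)
  have dep: "depends_on n (\<lambda>w. K * q 0 w n \<le> mass w n)"
    by (rule depends_on_compose2[OF dq dm, where h="\<lambda>x y. K * x \<le> y"])
  have "measure (\<nu> 0) {w\<in>codes 2. K * q 0 w n \<le> mass w n} = (\<Sum>v\<in>{v\<in>words n. K * q 0 v n \<le> mass v n}. q 0 v n)"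
    by (rule measure_\<nu>_words[OF dep])
  also have "\<dots> \<le> (\<Sum>v\<in>{v\<in>words n. K * q 0 v n \<le> mass v n}. mass v n / K)"
    using assms by (intro sum_mono) (auto simp: field_simps)
  also have "\<dots> \<le> (\<Sum>v\<in>words n. mass v n / K)"
    using assms by (intro sum_mono2 finite_words) (auto simp: mass_def)
  also have "\<dots> = 1 / K" by (simp add: sum_divide_distrib[symmetric] sum_mass_words)
  finally show ?thesis .
qed

end

context cyclic_ifs
begin

text \<open>
  The image of \<open>Q\<close> is the special coordinate axis. Distances there see only the contraction
  \<open>(q 0 w n)\<^sup>2\<close>, which for codes typical for another phase is much smaller than the squared mass of the
  cylinder.
\<close>

definition Q :: "real^'n \<Rightarrow> real^'n" where
  "Q x = (\<chi> s. if s = e 0 then x $ s else 0)"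

lemma linear_Q: "linear Q"
  by (rule linearI) (auto simp: Q_def vec_eq_iff)

lemma proper_projection_Q: "proper_projection Q"
  unfolding proper_projection_def
proof (intro conjI linear_Q)
  show "Q \<circ> Q = Q" by (auto simp: Q_def vec_eq_iff)
  have "Q x = (x $ e 0) *\<^sub>R axis (e 0) 1" for x by (auto simp: Q_def vec_eq_iff axis_def)
  then have "range Q \<subseteq> span {axis (e 0) 1}" by (metis image_subsetI insertI1 span_base span_scale)
  then have "dim (range Q) \<le> 1" using dim_le_card[of "range Q" "{axis (e 0) 1}"] by simp
  then show "dim (range Q) < CARD('n)" using two_le_d d_card by simp
qed

lemma dist_Q: "dist (Q x) (Q y) = \<bar>x $ e 0 - y $ e 0\<bar>"
proof -
  have "Q x - Q y = (x $ e 0 - y $ e 0) *\<^sub>R axis (e 0) 1" by (auto simp: Q_def vec_eq_iff axis_def)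
  then show ?thesis by (simp add: dist_norm norm_axis_1)
qed

lemma measurable_Q: "Q \<in> borel_measurable borel"
  by (rule borel_measurable_continuous_onI[OF linear_continuous_on[OF linear_Q[unfolded linear_conv_bounded_linear]]])

definition \<kappa>Q :: "(real^'n) measure" where "\<kappa>Q = distr \<kappa> borel Q"

lemma \<kappa>Q_eq: "\<kappa>Q = distr \<mu> borel (\<lambda>w. Q (pt w))"
  unfolding \<kappa>Q_def coding_measure_def
  by (subst distr_distr[OF measurable_Q measurable_pt]) (auto simp: comp_def)

lemma measurable_Q_pt: "sets M = sets code_space \<Longrightarrow> (\<lambda>w. Q (pt w)) \<in> borel_measurable M"
  by (rule measurable_compose[OF measurable_pt measurable_Q])

lemma measure_\<kappa>Q_cball:
  "measure \<kappa>Q (cball (Q (pt w)) r) = measure \<mu> {w'\<in>codes 2. \<bar>coord 0 w' - coord 0 w\<bar> \<le> r}"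
  "{w'\<in>codes 2. \<bar>coord 0 w' - coord 0 w\<bar> \<le> r} \<in> sets code_space"
proof -
  have idx0: "idx (e 0) = 0" using d_pos by (rule idx_e)
  have pre: "(\<lambda>w. Q (pt w)) -` cball (Q (pt w)) r \<inter> codes 2 = {w'\<in>codes 2. \<bar>coord 0 w' - coord 0 w\<bar> \<le> r}"
    by (auto simp: dist_Q idx0 abs_minus_commute)
  show "measure \<kappa>Q (cball (Q (pt w)) r) = measure \<mu> {w'\<in>codes 2. \<bar>coord 0 w' - coord 0 w\<bar> \<le> r}"
    unfolding \<kappa>Q_eq by (subst measure_distr[OF measurable_Q_pt]) (auto simp: pre)
  show "{w'\<in>codes 2. \<bar>coord 0 w' - coord 0 w\<bar> \<le> r} \<in> sets code_space"
    using measurable_sets[OF measurable_Q_pt[of code_space], of "cball (Q (pt w)) r"] by (simp add: pre)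
qed

lemma mass_le_\<kappa>Q_cball:
  assumes "w \<in> codes 2" "(q 0 w n)\<^sup>2 \<le> r"
  shows "mass w n \<le> measure \<kappa>Q (cball (Q (pt w)) r)"
proof -
  interpret prob_space \<mu> by (rule prob_space_\<mu>)
  have "cyl w n \<subseteq> {w'\<in>codes 2. \<bar>coord 0 w' - coord 0 w\<bar> \<le> r}"
    using coord_near[OF assms(1), of _ n 0] assms(2) cyl_sub by (auto intro: order_trans)
  then show ?thesis unfolding mass_def measure_\<kappa>Q_cball(1)
    using measure_\<kappa>Q_cball(2) by (intro finite_measure_mono) auto
qed

lemma \<kappa>Q_cball_le_mass:
  assumes "w \<in> codes 2" "r < 8/25 * (q 0 w n)\<^sup>2"
  shows "measure \<kappa>Q (cball (Q (pt w)) r) \<le> mass w n"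
proof -
  interpret prob_space \<mu> by (rule prob_space_\<mu>)
  have "{w'\<in>codes 2. \<bar>coord 0 w' - coord 0 w\<bar> \<le> r} \<subseteq> cyl w n"
    by (auto intro!: coord_far[OF assms(1)] le_less_trans[OF _ assms(2)])
  then show ?thesis unfolding mass_def measure_\<kappa>Q_cball(1) by (intro finite_measure_mono) auto
qed

lemma AE_\<kappa>Q:
  assumes "has_dimension \<kappa>Q a" "p < d"
  shows "AE w in \<nu> p. w \<in> codes 2 \<and> upper_local_dim \<kappa>Q (Q (pt w)) = a \<and> lower_local_dim \<kappa>Q (Q (pt w)) = a"
proof -
  have "AE x in distr \<mu> borel (\<lambda>w. Q (pt w)). upper_local_dim \<kappa>Q x = a \<and> lower_local_dim \<kappa>Q x = a"
    using assms(1) unfolding has_dimension_def \<kappa>Q_eq[symmetric] .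
  from AE_\<mu>_imp_\<nu>[OF AE_distrD[OF measurable_Q_pt[OF sets_\<mu>] this] assms(2)]
  show ?thesis using AE_space[of "\<nu> p"] by eventually_elim simp
qed

lemma depends_on_q: "depends_on n (\<lambda>w. q p w n)"
  by (auto simp: depends_on_def intro: q_cong)

lemma q2_pos_tendsto:
  assumes "w \<in> codes 2" "0 < c"
  shows "0 < c * (q p w n)\<^sup>2" "(\<lambda>n. c * (q p w n)\<^sup>2) \<longlonglongrightarrow> 0"
  using q_pos[OF assms(1), of p n] assms(2) tendsto_mult[OF tendsto_const q2_tendsto_0, of c p w] by simp_all

text \<open>
  A local dimension of at least \<open>1/2\<close> would give, for \<open>\<nu> 1\<close>-almost all codes,
  \<open>q 1 \<le> d * mass \<le> K n * q 0\<close> with \<open>K n\<close> of arbitrarily small exponential growth. The affinity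
  estimate excludes this.
\<close>

lemma not_has_dimension_ge_half:
  assumes dim: "has_dimension \<kappa>Q a" and a: "ereal (1/2) \<le> a"
  shows False
proof -
  \<comment> \<open>With this \<open>\<epsilon>\<close>, \<open>K n\<close> grows like \<open>(50/49)\<^sup>N\<close> along \<open>n = N * d\<close>, so that \<open>sqrt (K n)\<close> compensates only
    half of the decay \<open>(49/50)\<^sup>N\<close>.\<close>
  define \<epsilon> where "\<epsilon> = ln (50/49) / (2 * d * ln 5)"
  have \<epsilon>: "0 < \<epsilon>" using d_pos by (simp add: \<epsilon>_def)
  define K where "K n = d * exp (2 * \<epsilon> * ln 5 * real n)" for n
  have K_pos: "0 < K n" for n using d_pos by (simp add: K_def)
  define P where "P n w \<longleftrightarrow> q 1 w n \<le> K n * q 0 w n" for n w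
  have P_dep: "depends_on n (P n)" for n
    unfolding P_def[abs_def] by (rule depends_on_compose2[OF depends_on_q depends_on_q, where h="\<lambda>x y. x \<le> K n * y"])
  have "1 < d" using two_le_d by simp
  have "AE w in \<nu> 1. eventually (\<lambda>n. P n w) sequentially"
    using AE_\<kappa>Q[OF dim \<open>1 < d\<close>]
  proof eventually_elim
    case (elim w)
    then have w: "w \<in> codes 2" by simp
    have "eventually (\<lambda>n. measure \<kappa>Q (cball (Q (pt w)) (1 * (q 0 w n)\<^sup>2)) \<le> (1 * (q 0 w n)\<^sup>2) powr (1/2 - \<epsilon>)) sequentially"
    proof (rule lower_local_dim_ball_bound)
      have "ereal (1/2 - \<epsilon>) < ereal (1/2)" using \<epsilon> by simp
      also have "\<dots> \<le> lower_local_dim \<kappa>Q (Q (pt w))" using a elim by simp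
      finally show "ereal (1/2 - \<epsilon>) < lower_local_dim \<kappa>Q (Q (pt w))" .
    qed (use q2_pos_tendsto[OF w, of 1] in auto)
    then show ?case
    proof eventually_elim
      case (elim n)
      have "q 1 w n \<le> d * mass w n" using two_le_d by (intro q_le_mass) simp
      also have "mass w n \<le> measure \<kappa>Q (cball (Q (pt w)) (1 * (q 0 w n)\<^sup>2))" by (rule mass_le_\<kappa>Q_cball[OF w]) simp
      also note elim
      also have "(1 * (q 0 w n)\<^sup>2) powr (1/2 - \<epsilon>) \<le> exp (2 * \<epsilon> * ln 5 * real n) * q 0 w n"
        using powr_half_minus_le[OF q_ge[OF w] \<epsilon>] by simp
      finally show ?case by (simp add: P_def K_def mult.assoc mult_left_mono)
    qed
  qed
  moreover have "measure (\<nu> 1) {w\<in>codes 2. P (N * d) w} \<le> sqrt d * sqrt (49/50) ^ N" for N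
  proof -
    have "2 * \<epsilon> * ln 5 * real (N * d) = real N * ln (50/49)" using d_pos by (simp add: \<epsilon>_def)
    then have "exp (2 * \<epsilon> * ln 5 * real (N * d)) = (50/49) ^ N"
      by (simp only: exp_of_nat_mult) simp
    then have K: "K (N * d) = d * (50/49) ^ N" by (simp only: K_def)
    have "measure (\<nu> 1) {w\<in>codes 2. P (N * d) w} \<le> sqrt (K (N * d)) * (49/50) ^ N"
      unfolding P_def using K_pos by (intro \<nu>_1_small less_imp_le)
    also have "(49/50::real) ^ N = sqrt (49/50) ^ N * sqrt (49/50) ^ N"
      by (simp add: power_mult_distrib[symmetric])
    also have "sqrt (K (N * d)) * \<dots> = sqrt d * (sqrt (50/49) * sqrt (49/50)) ^ N * sqrt (49/50) ^ N"
      by (simp add: K real_sqrt_mult real_sqrt_power power_mult_distrib)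
    also have "\<dots> = sqrt d * sqrt (49/50) ^ N" by (simp add: real_sqrt_mult[symmetric])
    finally show ?thesis .
  qed
  moreover have "(\<lambda>N. sqrt d * sqrt (49/50) ^ N) \<longlonglongrightarrow> 0"
    by (rule tendsto_eq_rhs[OF tendsto_mult[OF tendsto_const LIMSEQ_realpow_zero]]) auto
  moreover have "strict_mono (\<lambda>N. N * d)" using d_pos by (intro strict_monoI) simp
  ultimately show False by (rule \<nu>_not_eventually[OF P_dep])
qed

text \<open>
  A local dimension below \<open>b < 1/2\<close> would give, for \<open>\<nu> 0\<close>-almost all codes, masses of at least
  \<open>(q 0)\<close> to the power \<open>2 b\<close>, which exceeds \<open>q 0\<close> by a factor growing exponentially. Markov's
  inequality excludes this.
\<close>

lemma not_has_dimension_less_half: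
  assumes dim: "has_dimension \<kappa>Q a" and a: "a < ereal (1/2)"
  shows False
proof -
  obtain b where b: "a < ereal b" "b < 1/2" using ereal_dense2[OF a] by auto
  define C where "C = (4/25::real) powr b"
  define \<gamma> where "\<gamma> = (5/4::real) powr (1 - 2 * b)"
  have C: "0 < C" by (simp add: C_def)
  have \<gamma>: "1 < \<gamma>" using b(2) by (simp add: \<gamma>_def)
  define P where "P n w \<longleftrightarrow> C * \<gamma> ^ n * q 0 w n \<le> mass w n" for n w
  have mass_dep: "depends_on n (\<lambda>w. mass w n)" for n unfolding mass_def by (rule depends_on_cyl_center)
  have P_dep: "depends_on n (P n)" for n
    unfolding P_def[abs_def] by (rule depends_on_compose2[OF depends_on_q mass_dep, where h="\<lambda>x y. C * \<gamma> ^ n * x \<le> y"])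
  have "AE w in \<nu> 0. eventually (\<lambda>n. P n w) sequentially"
    using AE_\<kappa>Q[OF dim d_pos]
  proof eventually_elim
    case (elim w)
    then have w: "w \<in> codes 2" by simp
    \<comment> \<open>\<open>4/25\<close> is half of the separation constant \<open>8/25\<close>.\<close>
    note r = q2_pos_tendsto[OF w, of "4/25" 0]
    have mass: "0 < measure \<kappa>Q (cball (Q (pt w)) r)" if r: "0 < r" for r
    proof -
      obtain N where "(q 0 w N)\<^sup>2 < r"
        using order_tendstoD(2)[OF q2_tendsto_0[of 0 w] r] by (auto simp: eventually_sequentially)
      then have "mass w N \<le> measure \<kappa>Q (cball (Q (pt w)) r)" by (intro mass_le_\<kappa>Q_cball[OF w]) simp
      then show ?thesis using mass_pos[OF w, of N] by linarith
    qed
    have "eventually (\<lambda>n. (4/25 * (q 0 w n)\<^sup>2) powr b \<le> measure \<kappa>Q (cball (Q (pt w)) (4/25 * (q 0 w n)\<^sup>2))) sequentially"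
    proof (rule upper_local_dim_ball_bound)
      show "upper_local_dim \<kappa>Q (Q (pt w)) < ereal b" using b(1) elim by simp
    qed (use r mass in auto)
    then show ?case
    proof eventually_elim
      case (elim n)
      have qp: "0 < q 0 w n" by (rule q_pos[OF w])
      have "\<gamma> ^ n * q 0 w n = ((5/4) ^ n) powr (1 - 2 * b) * q 0 w n"
        by (simp add: \<gamma>_def powr_realpow[symmetric] powr_powr mult.commute)
      also have "\<dots> \<le> (1 / q 0 w n) powr (1 - 2 * b) * q 0 w n"
      proof (intro mult_right_mono powr_mono2)
        have "(5/4) ^ n * q 0 w n \<le> (5/4) ^ n * (4/5) ^ n" by (intro mult_left_mono q_le) simp
        also have "\<dots> = 1" by (simp add: power_mult_distrib[symmetric])
        finally show "(5/4) ^ n \<le> 1 / q 0 w n" using qp by (simp add: pos_le_divide_eq)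
      qed (use b qp in auto)
      also have "\<dots> = q 0 w n powr (2 * b)"
        using qp by (simp add: powr_divide powr_diff)
      also have "\<dots> = ((q 0 w n)\<^sup>2) powr b" using qp by (simp add: powr_powr[symmetric] powr_numeral)
      finally have "C * (\<gamma> ^ n * q 0 w n) \<le> C * ((q 0 w n)\<^sup>2) powr b" using C by (intro mult_left_mono) auto
      also have "\<dots> = (4/25 * (q 0 w n)\<^sup>2) powr b" 
        unfolding C_def by (rule powr_mult[symmetric])
      also note elim
      also have "measure \<kappa>Q (cball (Q (pt w)) (4/25 * (q 0 w n)\<^sup>2)) \<le> mass w n"
        using qp by (intro \<kappa>Q_cball_le_mass[OF w]) simp
      finally show ?case by (simp add: P_def mult.assoc)
    qed
  qed
  moreover have "measure (\<nu> 0) {w\<in>codes 2. P n w} \<le> 1 / C * (1 / \<gamma>) ^ n" for n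
    using \<nu>_0_small[of "C * \<gamma> ^ n" n] C \<gamma> by (simp add: P_def power_one_over)
  moreover have "(\<lambda>n. 1 / C * (1 / \<gamma>) ^ n) \<longlonglongrightarrow> 0"
    using \<gamma> by (intro tendsto_eq_rhs[OF tendsto_mult[OF tendsto_const LIMSEQ_realpow_zero]]) auto
  moreover have "strict_mono (\<lambda>n::nat. n)" by (simp add: strict_mono_def)
  ultimately show False by (rule \<nu>_not_eventually[OF P_dep])
qed

lemma not_exact_dimensional_\<kappa>Q: "\<not> exact_dimensional (distr \<kappa> borel Q)"
  using not_has_dimension_ge_half not_has_dimension_less_half
  unfolding exact_dimensional_def \<kappa>Q_def[symmetric] by (meson not_le)

end

theorem theorem3:
  assumes "CARD('n::finite) \<ge> 2"
  shows "\<exists>(m::nat) (A :: nat \<Rightarrow> real^'n^'n) (u :: nat \<Rightarrow> real^'n).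
    affine_ifs m A u \<and> irreducible_ifs m A \<and>
    (\<exists>\<mu>. ergodic_prob m \<mu> \<and>
      has_dimension (coding_measure A u \<mu>) (hausdorff_dimension (attractor m A u)) \<and>
      (\<forall>\<mu>'. shift_invariant_prob m \<mu>' \<and>
          has_dimension (coding_measure A u \<mu>') (hausdorff_dimension (attractor m A u)) \<longrightarrow>
          coding_measure A u \<mu>' = coding_measure A u \<mu>) \<and>
      (\<exists>Q :: real^'n \<Rightarrow> real^'n. proper_projection Q \<and>
          \<not> exact_dimensional (distr (coding_measure A u \<mu>) borel Q)))"
proof -
  obtain e :: "nat \<Rightarrow> 'n" where e: "bij_betw e {..<CARD('n)} UNIV"
    using ex_bij_betw_nat_finite[of "UNIV :: 'n set"] by (auto simp: atLeast0LessThan)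
  interpret cyclic_ifs "CARD('n)" e "inv_into {..<CARD('n)} e"
  proof
    show "2 \<le> CARD('n)" by (rule assms)
    fix t :: 'n
    have t: "t \<in> e ` {..<CARD('n)}" using bij_betw_imp_surj_on[OF e] by simp
    show "inv_into {..<CARD('n)} e t < CARD('n)" using inv_into_into[OF t] by simp
    show "e (inv_into {..<CARD('n)} e t) = t" by (rule f_inv_into_f[OF t])
  next
    show "k < CARD('n) \<Longrightarrow> inv_into {..<CARD('n)} e (e k) = k" for k
      using bij_betw_imp_inj_on[OF e] by (simp add: inv_into_f_f)
  qed simp
  show ?thesis
    using affine_ifs irreducible ergodic_\<mu> has_dimension_\<kappa> unique_dimension_half
      proper_projection_Q not_exact_dimensional_\<kappa>Q
    by (intro exI[of _ 2] exI[of _ A] exI[of _ u] exI[of _ \<mu>] conjI exI[of _ Q] allI impI)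
      (auto simp: hausdorff_dimension_attractor)
qed

end
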